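(* Assume that $\lambda^{(N)}\to\lambda$ as $N\to\infty$ (convergence of probability distributions), where $\lambda$ is a probability distribution on $[0,\infty)$ with $\lambda(\{0\})=0$ and $\int_0^\infty w\,\lambda(dw)<\infty$. Let the initial configurations $(X^{(N)}_1(0),\dots,X^{(N)}_N(0))=(x^{(N)}_{1,0},\dots,x^{(N)}_{N,0})$ be given and such that the initial empirical distribution $\mu^{(N)}_0$ converges weakly as $N\to\infty$ to a probability distribution $\mu_0(dw,dy)=\mu_{y,0}(dw)\,dy$ on $[0,\infty)\times[0,1)$ whose second marginal is Lebesgue measure on $[0,1)$. Then for $t\ge0$ and $0\le x<1$, the search cost $C_N(t)$ at time $t$ satisfies $$\lim_{N\to\infty}\mathrm{P}\Big[\frac1N C_N(t)>x\Big]=\frac{\iint_{(w,y)\in[0,\infty)\times(x,1)} w\,\mu_{y,t}(dw)\,dy}{\int_0^\infty w\,\lambda(dw)},$$ where $$\mu_{y,t}(dw)=\begin{cases}\dfrac{w e^{-wt_0(y)}\lambda(dw)}{\int_0^\infty\tilde w e^{-\tilde w t_0(y)}\lambda(d\tilde w)}, & y<y_C(t),\\[3mm] \dfrac{e^{-wt}\mu_{\hat y(y,t),0}(dw)}{\int_0^\infty e^{-\tilde w t}\mu_{\hat y(y,t),0}(d\tilde w)}, & y>y_C(t).\end{cases}$$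
   Context: Stochastic ranking process (continuous-time move-to-front process): for each $N$ there are items $1,\dots,N$ in a queue with positions $X^{(N)}(t)=(X^{(N)}_1(t),\dots,X^{(N)}_N(t))$, a permutation of $(1,\dots,N)$ (position $1$ is the top). Item $i$ has a jump rate $w^{(N)}_i>0$ and jumps at the points $\tau^{(N)}_{i,1}<\tau^{(N)}_{i,2}<\cdots$ of a Poisson process on $(0,\infty)$ of rate $w^{(N)}_i$; these Poisson processes are independent over $i$. When an item jumps it is moved to position $1$, every item that was above it (smaller position) moves down by one position, and all other items keep their positions. Search cost at time $t$: let $I^{(N)}(t)$ be the (a.s. unique) item making the first jump strictly after time $t$. Then $C_N(t)=X^{(N)}_{I^{(N)}(t)}(t)$. $\mathrm{P}$ denotes probability for the process started from the given initial configuration. Empirical distributions: $\lambda^{(N)}=\frac1N\sum_{i=1}^N\delta_{w^{(N)}_i}$ and $\mu^{(N)}_0=\frac1N\sum_{i=1}^N\delta_{(w^{(N)}_i,Y^{(N)}_i(0))}$, where $Y^{(N)}_i(t)=\frac1N(X^{(N)}_i(t)-1)$ and $\delta_c$ is the unit mass at $c$. For almost every $y\in[0,1)$, $\mu_{y,0}$ is a probability measure on $[0,\infty)$ (disintegration of $\mu_0$ with respect to $dy$). Let $y_C(t)=1-\int_0^\infty e^{-wt}\lambda(dw)$ for $t\ge0$; it is a continuous strictly increasing bijection $[0,\infty)\to[0,1)$ with inverse $t_0:[0,1)\to[0,\infty)$. Let $y_C(y,t)=1-\int_y^1\int_0^\infty e^{-wt}\mu_{z,0}(dw)\,dz$ for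 $t\ge0$, $0\le y<1$; for each $t$, $y\mapsto y_C(y,t)$ is a continuous strictly increasing bijection $[0,1)\to[y_C(t),1)$, and $\hat y(\cdot,t):[y_C(t),1)\to[0,1)$ denotes its inverse.
   Formalization: The formal theorem also assumes that the mean jump rates (1/N)Σ w_i^(N) converge to ∫w λ(dw); with weak convergence λ^(N)→λ alone the claim fails (w_1=N², all other rates 1, X_i(0)=i). *)

theory Defs
  imports "HOL-Probability.Probability"
begin

text \<open>A point process on \<open>(0,\<infinity>)\<close> is given by the sequence \<open>\<tau> 0 < \<tau> 1 < \<dots>\<close> of its random points.\<close>

definition count_points :: "(nat \<Rightarrow> 'a \<Rightarrow> real) \<Rightarrow> real \<Rightarrow> real \<Rightarrow> 'a \<Rightarrow> nat" where
  "count_points \<tau> a b \<omega> = card {k. a < \<tau> k \<omega> \<and> \<tau> k \<omega> \<le> b}"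

definition (in prob_space) poisson_points :: "real \<Rightarrow> (nat \<Rightarrow> 'a \<Rightarrow> real) \<Rightarrow> bool" where
  "poisson_points r \<tau> \<longleftrightarrow>
     (\<forall>k. random_variable borel (\<tau> k)) \<and>
     (AE \<omega> in M. 0 < \<tau> 0 \<omega> \<and> strict_mono (\<lambda>k. \<tau> k \<omega>) \<and> filterlim (\<lambda>k. \<tau> k \<omega>) at_top sequentially) \<and>
     (\<forall>a b. 0 \<le> a \<longrightarrow> a < b \<longrightarrow>
        distr M (count_space UNIV) (count_points \<tau> a b) = measure_pmf (poisson_pmf (r * (b - a)))) \<and>
     (\<forall>s :: nat \<Rightarrow> real. 0 \<le> s 0 \<longrightarrow> strict_mono s \<longrightarrow>
        indep_vars (\<lambda>_. count_space UNIV) (\<lambda>j. count_points \<tau> (s j) (s (Suc j))) UNIV)"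

definition move_to_front :: "nat \<Rightarrow> (nat \<Rightarrow> nat) \<Rightarrow> nat \<Rightarrow> nat" where
  "move_to_front i x j = (if j = i then 1 else if x j < x i then x j + 1 else x j)"

text \<open>
  The path \<open>x\<close> of the queue driven by the jump times \<open>s i k\<close> of the items \<open>i\<close>.  Whenever the
  only jump in \<open>(a,b]\<close> takes place at \<open>b\<close>, the configuration at \<open>a\<close> is the one just before \<open>b\<close>.
  Simultaneous jumps, which have probability zero, are left unspecified.
\<close>

definition move_to_front_path ::
  "nat \<Rightarrow> (nat \<Rightarrow> nat) \<Rightarrow> (nat \<Rightarrow> nat \<Rightarrow> real) \<Rightarrow> (nat \<Rightarrow> real \<Rightarrow> nat) \<Rightarrow> bool" where
  "move_to_front_path N x0 s x \<longleftrightarrow>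
     (\<forall>i\<in>{1..N}. x i 0 = x0 i) \<and>
     (\<forall>a b. 0 \<le> a \<longrightarrow> a < b \<longrightarrow> (\<forall>j\<in>{1..N}. range (s j) \<inter> {a<..b} = {}) \<longrightarrow>
        (\<forall>j\<in>{1..N}. x j b = x j a)) \<and>
     (\<forall>a b. \<forall>i\<in>{1..N}. 0 \<le> a \<longrightarrow> a < b \<longrightarrow>
        (\<forall>j\<in>{1..N}. range (s j) \<inter> {a<..b} = (if j = i then {b} else {})) \<longrightarrow>
        (\<forall>j\<in>{1..N}. x j b = move_to_front i (\<lambda>l. x l a) j))"

locale stochastic_ranking_process = prob_space M
  for M :: "'a measure"
    and N :: nat
    and w :: "nat \<Rightarrow> real"
    and x0 :: "nat \<Rightarrow> nat"
    and \<tau> :: "nat \<Rightarrow> nat \<Rightarrow> 'a \<Rightarrow> real"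
    and X :: "nat \<Rightarrow> real \<Rightarrow> 'a \<Rightarrow> nat" +
  assumes rate_pos: "\<And>i. i \<in> {1..N} \<Longrightarrow> 0 < w i"
    and initial_permutation: "bij_betw x0 {1..N} {1..N}"
    and poisson: "\<And>i. i \<in> {1..N} \<Longrightarrow> poisson_points (w i) (\<tau> i)"
    and indep: "indep_vars (\<lambda>_. PiM UNIV (\<lambda>_. borel)) (\<lambda>i \<omega>. (\<lambda>k. \<tau> i k \<omega>)) {1..N}"
    and random_position:
      "\<And>i t. i \<in> {1..N} \<Longrightarrow> 0 \<le> t \<Longrightarrow> random_variable (count_space UNIV) (X i t)"
    and path: "AE \<omega> in M. move_to_front_path N x0 (\<lambda>i k. \<tau> i k \<omega>) (\<lambda>i t. X i t \<omega>)"

definition next_jump :: "(nat \<Rightarrow> real) \<Rightarrow> real \<Rightarrow> real" where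
  "next_jump s t = Inf {s k | k. t < s k}"

definition next_item :: "nat \<Rightarrow> (nat \<Rightarrow> nat \<Rightarrow> 'a \<Rightarrow> real) \<Rightarrow> real \<Rightarrow> 'a \<Rightarrow> nat" where
  "next_item N \<tau> t \<omega> = arg_min_on (\<lambda>i. next_jump (\<lambda>k. \<tau> i k \<omega>) t) {1..N}"

definition search_cost ::
  "nat \<Rightarrow> (nat \<Rightarrow> nat \<Rightarrow> 'a \<Rightarrow> real) \<Rightarrow> (nat \<Rightarrow> real \<Rightarrow> 'a \<Rightarrow> nat) \<Rightarrow> real \<Rightarrow> 'a \<Rightarrow> nat" where
  "search_cost N \<tau> X t \<omega> = X (next_item N \<tau> t \<omega>) t \<omega>"

text \<open>\<open>(1/N) \<Sum>\<^sub>i \<delta>\<^bsub>c i\<^esub>\<close> with \<open>i\<close> ranging over \<open>1..N\<close>, as a Borel measure.\<close>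

definition empirical :: "nat \<Rightarrow> (nat \<Rightarrow> 'b) \<Rightarrow> 'b::topological_space measure" where
  "empirical N c = distr (uniform_count_measure {1..N}) borel c"

lemma emeasure_empirical:
  assumes "A \<in> sets borel"
  shows "emeasure (empirical N c) A = ennreal (card {i\<in>{1..N}. c i \<in> A} / N)"
proof -
  have "c -` A \<inter> {1..N} = {i\<in>{1..N}. c i \<in> A}" by auto
  moreover have "c \<in> uniform_count_measure {1..N} \<rightarrow>\<^sub>M borel"
    by (simp add: measurable_def sets_uniform_count_measure space_uniform_count_measure)
  ultimately have "emeasure (empirical N c) A = emeasure (uniform_count_measure {1..N}) {i\<in>{1..N}. c i \<in> A}"
    unfolding empirical_def using assms
    by (simp only: emeasure_distr space_uniform_count_measure)
  also have "\<dots> = ennreal (card {i\<in>{1..N}. c i \<in> A} / card {1..N})"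
    by (rule emeasure_uniform_count_measure) auto
  finally show ?thesis by simp
qed

definition distribution_on :: "'b::topological_space set \<Rightarrow> 'b measure \<Rightarrow> bool" where
  "distribution_on S P \<longleftrightarrow> prob_space P \<and> sets P = sets borel \<and> (AE x in P. x \<in> S)"

text \<open>
  Weak convergence of distributions carried by a subspace \<open>S\<close>; the test functions are the bounded
  functions that are continuous on \<open>S\<close>.
\<close>

definition weak_conv_on :: "'b::topological_space set \<Rightarrow> (nat \<Rightarrow> 'b measure) \<Rightarrow> 'b measure \<Rightarrow> bool" where
  "weak_conv_on S P Q \<longleftrightarrow>
     (\<forall>f :: 'b \<Rightarrow> real. continuous_on S f \<longrightarrow> bounded (f ` S) \<longrightarrow>
        (\<lambda>n. LINT x:S|P n. f x) \<longlonglongrightarrow> (LINT x:S|Q. f x))"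

text \<open>\<open>\<mu>0(dw,dy) = K y (dw) dy\<close> on \<open>[0,\<infinity>) \<times> [0,1)\<close>.\<close>

definition disintegrates :: "(real \<times> real) measure \<Rightarrow> (real \<Rightarrow> real measure) \<Rightarrow> bool" where
  "disintegrates \<mu>0 K \<longleftrightarrow>
     K \<in> restrict_space borel {0..<1} \<rightarrow>\<^sub>M subprob_algebra borel \<and>
     (AE y in lborel. y \<in> {0..<1} \<longrightarrow> distribution_on {0..} (K y)) \<and>
     (\<forall>A\<in>sets borel. \<forall>B\<in>sets borel.
        emeasure \<mu>0 (A \<times> B) = (\<integral>\<^sup>+ y\<in>B \<inter> {0..<1}. emeasure (K y) A \<partial>lborel))"

definition y_C :: "real measure \<Rightarrow> real \<Rightarrow> real" where
  "y_C lam t = 1 - (LINT w|lam. exp (- w * t))"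

definition t_0 :: "real measure \<Rightarrow> real \<Rightarrow> real" where
  "t_0 lam = the_inv_into {0..} (y_C lam)"

definition y_flow :: "(real \<Rightarrow> real measure) \<Rightarrow> real \<Rightarrow> real \<Rightarrow> real" where
  "y_flow K y t = 1 - (LINT z:{y..<1}|lborel. LINT w|K z. exp (- w * t))"

definition y_hat :: "(real \<Rightarrow> real measure) \<Rightarrow> real \<Rightarrow> real \<Rightarrow> real" where
  "y_hat K y t = the_inv_into {0..<1} (\<lambda>z. y_flow K z t) y"

definition limit_distribution ::
  "real measure \<Rightarrow> (real \<Rightarrow> real measure) \<Rightarrow> real \<Rightarrow> real \<Rightarrow> real measure" where
  "limit_distribution lam K y t =
     (if y < y_C lam t
      then density lam (\<lambda>w. ennreal (w * exp (- w * t_0 lam y) / (LINT v|lam. v * exp (- v * t_0 lam y))))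
      else density (K (y_hat K y t))
             (\<lambda>w. ennreal (exp (- w * t) / (LINT v|K (y_hat K y t). exp (- v * t)))))"

end

theory Submission
  imports Defs
begin

text \<open>
  Give every item a depth at time \<open>t\<close>: if it has jumped during \<open>(0,t]\<close>, minus the time of its last
  jump, a number in \<open>[-t,0)\<close>; otherwise its initial relative position \<open>y \<in> [0,1)\<close>.  A move to the
  front makes the depth of the moving item the smallest one, so the queue at time \<open>t\<close> is sorted by
  depth: for every level \<open>r\<close>, the items of depth below \<open>r\<close> occupy the positions from 1 up to their
  number (\<open>leading_along_path\<close>, \<open>position_iff_deep\<close>).  The depths of different items are independent,
  and an item with rate \<open>v\<close> and initial position \<open>y\<close> has depth at least \<open>r\<close> with the explicit
  probability \<open>survival t r (v,y)\<close>; by Hoeffding's inequality the fraction of items above the level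
  \<open>r\<close> is nearly deterministic.  Since Poisson points have no memory, the item requested next is
  item \<open>i\<close> with probability \<open>w\<^sub>i / (\<Sum>\<^sub>j w\<^sub>j)\<close>, independently of its depth (\<open>prob_next_item\<close>).  Hence, up to
  exponentially small errors, the probability that the search cost exceeds \<open>x N\<close> lies between the
  rate-weighted averages of \<open>survival t r\<close> for levels \<open>r\<close> slightly above and slightly below the level
  at which the fraction of shallower items equals \<open>x\<close> (\<open>search_cost_tail_lower\<close>,
  \<open>search_cost_tail_upper\<close>).

  As \<open>N\<close> grows, an average of \<open>f(v) survival t r (v,y)\<close> over the items tends to its integral with
  respect to \<open>\<mu>0\<close> (\<open>average_survival_conv\<close>).  This integral is the mass of \<open>[r,\<infinity>)\<close> under
  \<open>depth_measure f\<close>, a measure with an explicit Lebesgue density.  The weight \<open>f = 1\<close> gives the limit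
  law of the depth and with it the limit \<open>position r\<close> of the fraction of items of depth below \<open>r\<close>; the
  weight \<open>f(v) = v\<close> gives the limit of the search probability, up to the factor \<open>\<integral> v \<lambda>(dv)\<close>.

  It remains to recognize the right-hand side.  The inverse \<open>depth_at\<close> of \<open>position\<close> is
  \<open>y \<mapsto> t\<^sub>0(y) - t\<close> below \<open>y\<^sub>C(t)\<close> and the inverse flow above it, so the two cases in the definition
  of \<open>\<mu>\<^bsub>y,t\<^esub>\<close> are the cases of negative and nonnegative depth, and the mean of \<open>\<mu>\<^bsub>y,t\<^esub>\<close> is the
  quotient of the densities of \<open>depth_measure (\<lambda>v. v)\<close> and \<open>depth_measure (\<lambda>_. 1)\<close> at \<open>depth_at y\<close>.
  As \<open>depth_at\<close> is the quantile function of \<open>depth_measure (\<lambda>_. 1)\<close>, it maps the uniform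
  distribution to that law, and the integral over \<open>y \<in> (x,1)\<close> becomes the mass of
  \<open>(depth_at x,\<infinity>)\<close> under \<open>depth_measure (\<lambda>v. v)\<close> (\<open>integral_limit_distribution\<close>).
\<close>

section \<open>Items at the front of the queue\<close>

text \<open>
  Only injectivity and positivity of the positions are kept: these are the parts of being a
  permutation that survive a move to the front by inspection and that the argument needs.
\<close>

definition queue :: "nat \<Rightarrow> (nat \<Rightarrow> nat) \<Rightarrow> bool" where
  "queue N x \<longleftrightarrow> inj_on x {1..N} \<and> (\<forall>i\<in>{1..N}. 1 \<le> x i)"

definition leading :: "nat \<Rightarrow> (nat \<Rightarrow> nat) \<Rightarrow> nat set \<Rightarrow> bool" where
  "leading N x S \<longleftrightarrow> S \<subseteq> {1..N} \<and> (\<forall>i\<in>S. x i \<le> card S) \<and> (\<forall>i\<in>{1..N} - S. card S < x i)"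

lemma queue_cong: "(\<And>i. i \<in> {1..N} \<Longrightarrow> x i = y i) \<Longrightarrow> queue N x \<longleftrightarrow> queue N y"
  unfolding queue_def by (auto simp: inj_on_def)

lemma leading_cong: "(\<And>i. i \<in> {1..N} \<Longrightarrow> x i = y i) \<Longrightarrow> leading N x S \<longleftrightarrow> leading N y S"
  unfolding leading_def by (auto simp: subset_eq)

lemma queue_move_to_front:
  assumes "queue N x" "i \<in> {1..N}"
  shows "queue N (move_to_front i x)"
proof -
  have inj: "\<And>a b. a \<in> {1..N} \<Longrightarrow> b \<in> {1..N} \<Longrightarrow> x a = x b \<Longrightarrow> a = b"
    and pos: "\<And>a. a \<in> {1..N} \<Longrightarrow> 1 \<le> x a"
    using assms(1) unfolding queue_def inj_on_def by blast+
  have "a = b" if "a \<in> {1..N}" "b \<in> {1..N}" "move_to_front i x a = move_to_front i x b" for a b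
  proof (rule ccontr)
    assume "a \<noteq> b"
    then have ne: "x a \<noteq> x b" "a = i \<or> x a \<noteq> x i" "b = i \<or> x b \<noteq> x i"
      using inj that assms(2) by blast+
    have pos3: "1 \<le> x a" "1 \<le> x b" "1 \<le> x i" using pos that assms(2) by blast+
    consider "a = i" "b \<noteq> i" | "a \<noteq> i" "b = i" | "a \<noteq> i" "b \<noteq> i"
      using \<open>a \<noteq> b\<close> by blast
    then show False
    proof cases
      case 1
      then have "(if x b < x i then x b + 1 else x b) = 1"
        using that(3) by (simp add: move_to_front_def)
      then show False using ne 1 pos3 by presburger
    next
      case 2
      then have "(if x a < x i then x a + 1 else x a) = 1"
        using that(3) by (simp add: move_to_front_def)
      then show False using ne 2 pos3 by presburger
    next
      case 3
      then have "(if x a < x i then x a + 1 else x a) = (if x b < x i then x b + 1 else x b)"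
        using that(3) by (simp add: move_to_front_def)
      then show False using ne 3 by presburger
    qed
  qed
  moreover have "1 \<le> move_to_front i x a" if "a \<in> {1..N}" for a
    using pos[OF that] by (simp add: move_to_front_def)
  ultimately show ?thesis unfolding queue_def inj_on_def by blast
qed

text \<open>
  If the moving item was leading already, the leading items are permuted among themselves;
  otherwise it joins them at position 1, and each leading item makes room by one position.
\<close>

lemma leading_move_to_front:
  assumes "queue N x" "leading N x S" "i \<in> {1..N}"
  shows "leading N (move_to_front i x) (insert i S)"
proof -
  have inj: "\<And>a. a \<in> {1..N} \<Longrightarrow> x a = x i \<Longrightarrow> a = i"
    and pos: "\<And>a. a \<in> {1..N} \<Longrightarrow> 1 \<le> x a"
    using assms(1,3) unfolding queue_def inj_on_def by blast+
  have S: "S \<subseteq> {1..N}" "\<And>j. j \<in> S \<Longrightarrow> x j \<le> card S" "\<And>j. j \<in> {1..N} \<Longrightarrow> j \<notin> S \<Longrightarrow> card S < x j"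
    using assms(2) unfolding leading_def by blast+
  have fin: "finite S" using S(1) finite_subset by blast
  show ?thesis
  proof (cases "i \<in> S")
    case True
    then have "insert i S = S" by auto
    moreover have "1 \<le> card S" using True fin by (simp add: Suc_le_eq card_gt_0_iff) blast
    moreover have "move_to_front i x j \<le> card S" if "j \<in> S" for j
      using S(2)[OF that] S(2)[OF True] \<open>1 \<le> card S\<close> by (auto simp: move_to_front_def)
    moreover have "card S < move_to_front i x j" if "j \<in> {1..N}" "j \<notin> S" for j
      using S(3)[OF that] S(2)[OF True] that True by (auto simp: move_to_front_def)
    ultimately show ?thesis using S(1) unfolding leading_def by auto
  next
    case False
    have "move_to_front i x j \<le> Suc (card S)" if "j \<in> insert i S" for j
      using S(2)[of j] that by (auto simp: move_to_front_def)
    moreover have "Suc (card S) < move_to_front i x j" if "j \<in> {1..N}" "j \<notin> insert i S" for j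
    proof -
      have "x j \<noteq> x i" using inj that by blast
      then show ?thesis
        using S(3)[of j] S(3)[OF assms(3) False] that by (auto simp: move_to_front_def)
    qed
    ultimately show ?thesis using S(1) assms(3) fin False unfolding leading_def by auto
  qed
qed

text \<open>
  The path is specified only across intervals containing at most one jump, at the right end
  point.  The induction on the number of jumps in \<open>(a,b]\<close> removes the last jump \<open>c\<close>: the interval from the
  preceding jump \<open>d\<close> (or from \<open>a\<close>) to \<open>c\<close> is of that kind, and nothing moves on \<open>(c,b]\<close>.  Local finiteness
  and the absence of simultaneous jumps are what makes this decomposition available.
\<close>

lemma leading_along_path:
  fixes s :: "nat \<Rightarrow> nat \<Rightarrow> real"
  assumes path: "move_to_front_path N x0 s x"
    and fin: "\<And>j T. j \<in> {1..N} \<Longrightarrow> finite (range (s j) \<inter> {0<..T})"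
    and disj: "\<And>i j. i \<in> {1..N} \<Longrightarrow> j \<in> {1..N} \<Longrightarrow> i \<noteq> j \<Longrightarrow> range (s i) \<inter> range (s j) = {}"
    and a: "0 \<le> a" and start: "queue N (\<lambda>i. x i a)" "leading N (\<lambda>i. x i a) S"
  shows "a \<le> b \<Longrightarrow> queue N (\<lambda>i. x i b) \<and>
    leading N (\<lambda>i. x i b) (S \<union> {j\<in>{1..N}. range (s j) \<inter> {a<..b} \<noteq> {}})"
proof (induction "card (\<Union>j\<in>{1..N}. range (s j) \<inter> {a<..b})" arbitrary: b rule: less_induct)
  case less
  define J where "J c = (\<Union>j\<in>{1..N}. range (s j) \<inter> {a<..c})" for c
  have finJ: "finite (J c)" for c
    unfolding J_def
  proof (intro finite_UN_I)
    fix j assume "j \<in> {1..N}"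
    then show "finite (range (s j) \<inter> {a<..c})"
      by (rule finite_subset[OF _ fin[of j c], rotated]) (use a in auto)
  qed auto
  show ?case
  proof (cases "J b = {}")
    case True
    have none: "\<forall>j\<in>{1..N}. range (s j) \<inter> {a<..b} = {}" using True by (auto simp: J_def)
    have eq: "x j b = x j a" if "j \<in> {1..N}" for j
    proof (cases "a = b")
      case False
      then have "a < b" using less.prems by simp
      then show ?thesis using path none a that unfolding move_to_front_path_def by blast
    qed simp
    have "S \<union> {j\<in>{1..N}. range (s j) \<inter> {a<..b} \<noteq> {}} = S" using none by blast
    then show ?thesis
      using start queue_cong[of N "\<lambda>i. x i b" "\<lambda>i. x i a"] leading_cong[of N "\<lambda>i. x i b" "\<lambda>i. x i a"] eq
      by simp
  next
    case False
    define c where "c = Max (J b)"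
    define d where "d = Max (insert a (J b - {c}))"
    have c: "c \<in> J b" unfolding c_def using False finJ by simp
    have cmax: "\<And>z. z \<in> J b \<Longrightarrow> z \<le> c" unfolding c_def using finJ by simp
    have ac: "a < c" "c \<le> b" using c by (auto simp: J_def)
    have "d \<in> insert a (J b - {c})" unfolding d_def using finJ by (intro Max_in) auto
    then have ad: "a \<le> d" and dc: "d < c" using cmax ac by (force simp: J_def)+
    have dmax: "\<And>z. z \<in> J b \<Longrightarrow> z \<noteq> c \<Longrightarrow> z \<le> d" unfolding d_def using finJ by simp
    obtain i where i: "i \<in> {1..N}" "c \<in> range (s i)" using c by (auto simp: J_def)
    have "{a<..d} \<subseteq> {a<..b}" using dc ac by auto
    then have "J d \<subseteq> J b" unfolding J_def by blast
    moreover have "c \<notin> J d" using dc by (auto simp: J_def)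
    ultimately have "J d \<subset> J b" using c by blast
    then have "card (J d) < card (J b)" by (intro psubset_card_mono finJ)
    then have IH: "queue N (\<lambda>i. x i d)"
      "leading N (\<lambda>i. x i d) (S \<union> {j\<in>{1..N}. range (s j) \<inter> {a<..d} \<noteq> {}})"
      using less.hyps[of d] ad by (auto simp: J_def)
    have jump: "range (s j) \<inter> {d<..c} = (if j = i then {c} else {})" if j: "j \<in> {1..N}" for j
    proof -
      have "z = c" if z: "z \<in> range (s j)" "d < z" "z \<le> c" for z
      proof (rule ccontr)
        assume "z \<noteq> c"
        have "z \<in> {a<..b}" using z ad ac by auto
        then have "z \<in> J b" unfolding J_def using z j by blast
        then show False using dmax[OF _ \<open>z \<noteq> c\<close>] z by simp
      qed
      then have sub: "range (s j) \<inter> {d<..c} \<subseteq> {c}"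
        unfolding subset_eq by (metis Int_iff greaterThanAtMost_iff singletonI)
      have "c \<in> {d<..c}" using dc by simp
      show ?thesis
      proof (cases "j = i")
        case True
        then have "range (s j) \<inter> {d<..c} = {c}" using sub i(2) \<open>c \<in> {d<..c}\<close> by blast
        then show ?thesis using True by simp
      next
        case False
        then have "range (s j) \<inter> {d<..c} = {}" using sub disj[OF j i(1)] i(2) by blast
        then show ?thesis using False by simp
      qed
    qed
    have "\<forall>j\<in>{1..N}. x j c = move_to_front i (\<lambda>l. x l d) j"
      using path a ad dc i(1) jump unfolding move_to_front_path_def by (meson order_trans)
    moreover have "x j b = x j c" if j: "j \<in> {1..N}" for j
    proof (cases "c = b")
      case False
      then have "c < b" using ac by simp
      moreover have "range (s j) \<inter> {c<..b} = {}" if "j \<in> {1..N}" for j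
      proof -
        have "z \<in> J b" if "z \<in> range (s j)" "z \<in> {c<..b}" for z
        proof -
          have "z \<in> {a<..b}" using that ac by auto
          then show ?thesis unfolding J_def using that \<open>j \<in> {1..N}\<close> by blast
        qed
        then show ?thesis using cmax by fastforce
      qed
      ultimately show ?thesis using path a ac j unfolding move_to_front_path_def
        by (meson less_imp_le order_trans)
    qed simp
    ultimately have xb: "x j b = move_to_front i (\<lambda>l. x l d) j" if "j \<in> {1..N}" for j
      using that by simp
    have "insert i (S \<union> {j\<in>{1..N}. range (s j) \<inter> {a<..d} \<noteq> {}}) =
        S \<union> {j\<in>{1..N}. range (s j) \<inter> {a<..b} \<noteq> {}}" (is "?L = ?R")
    proof -
      have "c \<in> {a<..b}" "{a<..d} \<subseteq> {a<..b}" using ac dc by auto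
      then have "j \<in> ?R" if "j \<in> ?L" for j
        using that i by blast
      moreover have "j \<in> ?L" if "j \<in> ?R" for j
      proof (rule ccontr)
        assume n: "j \<notin> ?L"
        with that obtain z where z: "j \<in> {1..N}" "z \<in> range (s j)" "z \<in> {a<..b}" by blast
        then have "z \<in> J b" unfolding J_def by blast
        moreover have "z \<noteq> c" using n z disj[OF z(1) i(1)] i by blast
        ultimately have "z \<le> d" by (rule dmax)
        then have "z \<in> {a<..d}" using z by simp
        then show False using n z by blast
      qed
      ultimately show ?thesis by blast
    qed
    then show ?thesis
      using queue_move_to_front[OF IH(1) i(1)] leading_move_to_front[OF IH i(1)]
        queue_cong[of N "\<lambda>i. x i b", OF xb] leading_cong[of N "\<lambda>i. x i b", OF xb] by simp
  qed
qed

lemma leading_initial: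
  assumes "bij_betw x {1..N} {1..N}"
  shows "leading N x {i\<in>{1..N}. x i \<le> m}"
proof (cases "m \<le> N")
  case True
  have "x ` {i\<in>{1..N}. x i \<le> m} = {1..m}"
  proof
    show "x ` {i \<in> {1..N}. x i \<le> m} \<subseteq> {1..m}"
      using bij_betw_apply[OF assms] by fastforce
    show "{1..m} \<subseteq> x ` {i \<in> {1..N}. x i \<le> m}"
    proof
      fix k assume k: "k \<in> {1..m}"
      then have "k \<in> x ` {1..N}" using assms True by (auto simp: bij_betw_def)
      then show "k \<in> x ` {i \<in> {1..N}. x i \<le> m}" using k by auto
    qed
  qed
  moreover have "inj_on x {i\<in>{1..N}. x i \<le> m}"
    by (rule inj_on_subset[OF bij_betw_imp_inj_on[OF assms]]) blast
  ultimately have "card {i\<in>{1..N}. x i \<le> m} = m"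
    by (metis card_image card_atLeastAtMost diff_Suc_1)
  then show ?thesis by (auto simp: leading_def)
next
  case False
  then have "{i\<in>{1..N}. x i \<le> m} = {1..N}" using bij_betw_apply[OF assms] by fastforce
  then show ?thesis using bij_betw_apply[OF assms] by (auto simp: leading_def)
qed

section \<open>Poisson points\<close>

definition quiet :: "(nat \<Rightarrow> real) \<Rightarrow> real \<Rightarrow> real \<Rightarrow> bool" where
  "quiet s a b \<longleftrightarrow> (\<forall>k. \<not> (a < s k \<and> s k \<le> b))"

definition regular_points :: "(nat \<Rightarrow> real) \<Rightarrow> bool" where
  "regular_points s \<longleftrightarrow> 0 < s 0 \<and> strict_mono s \<and> filterlim s at_top sequentially"

lemma quiet_iff_disjoint: "quiet s a b \<longleftrightarrow> range s \<inter> {a<..b} = {}"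
  unfolding quiet_def by (auto simp: disjoint_iff)

lemma quiet_append: "a \<le> b \<Longrightarrow> b \<le> c \<Longrightarrow> quiet s a c \<longleftrightarrow> quiet s a b \<and> quiet s b c"
  unfolding quiet_def by (meson le_less_trans less_le_trans not_le order_trans)

lemma regular_points_pos: "regular_points s \<Longrightarrow> 0 < s k"
  unfolding regular_points_def by (metis le0 less_le_trans strict_mono_less_eq)

lemma regular_points_finite:
  assumes "regular_points s"
  shows "finite {k. s k \<le> T}"
proof -
  have "\<forall>\<^sub>F k in sequentially. T < s k"
    using assms by (simp add: regular_points_def filterlim_at_top_dense)
  then obtain m where m: "\<And>k. k \<ge> m \<Longrightarrow> T < s k"
    by (auto simp: eventually_sequentially)
  have "{k. s k \<le> T} \<subseteq> {..<m}"
    using m by (metis lessThan_iff mem_Collect_eq not_le subsetI)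
  then show ?thesis by (rule finite_subset) simp
qed

lemma next_jump_mem:
  assumes "regular_points s"
  shows "next_jump s t \<in> {s k | k. t < s k}" "t < s k \<Longrightarrow> next_jump s t \<le> s k"
proof -
  have "\<forall>\<^sub>F k in sequentially. t < s k"
    using assms by (simp add: regular_points_def filterlim_at_top_dense)
  then have ex: "\<exists>k. t < s k" by (auto simp: eventually_sequentially)
  define m where "m = (LEAST k. t < s k)"
  have m: "t < s m" "\<And>k. t < s k \<Longrightarrow> m \<le> k"
    unfolding m_def using ex by (auto intro: LeastI_ex Least_le)
  have sm: "s m \<le> s k" if "t < s k" for k
    using m(2)[OF that] assms by (simp add: regular_points_def strict_mono_less_eq)
  have "next_jump s t = s m"
    unfolding next_jump_def by (rule cInf_eq_minimum) (use m sm in auto)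
  then show "next_jump s t \<in> {s k | k. t < s k}" "t < s k \<Longrightarrow> next_jump s t \<le> s k"
    using m(1) sm by auto
qed

lemma next_jump_gt: "regular_points s \<Longrightarrow> t < next_jump s t"
  by (drule next_jump_mem(1)[where t = t]) auto

lemma next_jump_gt_iff_quiet:
  assumes "regular_points s"
  shows "v < next_jump s t \<longleftrightarrow> v \<le> t \<or> quiet s t v"
proof (cases "v \<le> t")
  case True
  then show ?thesis using next_jump_gt[OF assms, of t] by auto
next
  case False
  show ?thesis
  proof
    assume "v < next_jump s t"
    then show "v \<le> t \<or> quiet s t v"
      using next_jump_mem(2)[OF assms, of t] unfolding quiet_def by force
  next
    assume "v \<le> t \<or> quiet s t v"
    then have "quiet s t v" using False by simp
    moreover obtain k where "next_jump s t = s k" "t < s k"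
      using next_jump_mem(1)[OF assms, of t] by blast
    ultimately show "v < next_jump s t" unfolding quiet_def by force
  qed
qed

lemma measurable_quiet [measurable]:
  "Measurable.pred (PiM UNIV (\<lambda>_. borel)) (\<lambda>s. quiet s a b)"
  unfolding quiet_def by measurable

text \<open>
  The case distinction is about sequences without a point beyond \<open>t\<close>, for which the infimum is the
  unspecified constant \<open>Inf {}\<close>; they form a null set but belong to the sample space.
\<close>

lemma measurable_next_jump [measurable]:
  "(\<lambda>s. next_jump s t) \<in> borel_measurable (PiM UNIV (\<lambda>_. borel))"
proof (rule borel_measurableI_less)
  fix y :: real
  have "next_jump s t < y \<longleftrightarrow>
      (if \<exists>k. t < s k then \<exists>k. t < s k \<and> s k < y else Inf ({} :: real set) < y)" for s :: "nat \<Rightarrow> real"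
  proof (cases "\<exists>k. t < s k")
    case True
    have "bdd_below {s k | k. t < s k}" by (rule bdd_belowI[of _ t]) auto
    then show ?thesis unfolding next_jump_def using True by (subst cInf_less_iff) auto
  next
    case False
    then have "{s k | k. t < s k} = {}" by blast
    then show ?thesis unfolding next_jump_def using False by simp
  qed
  then show "{s \<in> space (PiM UNIV (\<lambda>_. borel)). next_jump s t < y} \<in> sets (PiM UNIV (\<lambda>_. borel))"
    by simp
qed

lemma measurable_points_component:
  "i \<in> I \<Longrightarrow> (\<lambda>u. u i k) \<in> borel_measurable (PiM I (\<lambda>_. PiM UNIV (\<lambda>_. borel)))"
  using measurable_compose[OF measurable_component_singleton[of i I "\<lambda>_. PiM UNIV (\<lambda>_. borel)"]
      measurable_component_singleton[of k UNIV "\<lambda>_. borel"]] by simp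

lemma (in prob_space) poisson_points_regular:
  "poisson_points r \<tau> \<Longrightarrow> AE \<omega> in M. regular_points (\<lambda>k. \<tau> k \<omega>)"
  unfolding poisson_points_def regular_points_def by blast

lemma (in prob_space) prob_quiet:
  assumes P: "poisson_points r \<tau>" and r: "0 < r" and ab: "0 \<le> a" "a \<le> b"
  shows "prob {\<omega>\<in>space M. quiet (\<lambda>k. \<tau> k \<omega>) a b} = exp (- r * (b - a))"
proof (cases "a = b")
  case True
  then have "{\<omega>\<in>space M. quiet (\<lambda>k. \<tau> k \<omega>) a b} = space M" by (auto simp: quiet_def)
  then show ?thesis using True by (simp add: prob_space)
next
  case False
  then have ab': "a < b" using ab by simp
  have [measurable]: "\<And>k. random_variable borel (\<tau> k)" using P by (simp add: poisson_points_def)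
  \<comment> \<open>Any increasing sequence starting with \<open>a, b\<close> gives measurability of the count on \<open>(a,b]\<close>.\<close>
  define s where "s = (\<lambda>j::nat. if j = 0 then a else b + real j - 1)"
  have "strict_mono s" unfolding s_def strict_mono_def using ab' by auto
  moreover have "0 \<le> s 0" using ab by (simp add: s_def)
  ultimately have "indep_vars (\<lambda>_. count_space UNIV) (\<lambda>j. count_points \<tau> (s j) (s (Suc j))) UNIV"
    using P unfolding poisson_points_def by blast
  then have "random_variable (count_space UNIV) (count_points \<tau> (s 0) (s (Suc 0)))"
    unfolding indep_vars_def by blast
  then have rv [measurable]: "random_variable (count_space UNIV) (count_points \<tau> a b)"
    by (simp add: s_def)
  have d: "distr M (count_space UNIV) (count_points \<tau> a b) = measure_pmf (poisson_pmf (r * (b - a)))"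
    using P ab ab' unfolding poisson_points_def by blast
  have "prob {\<omega>\<in>space M. quiet (\<lambda>k. \<tau> k \<omega>) a b} = prob {\<omega>\<in>space M. count_points \<tau> a b \<omega> = 0}"
  proof (rule finite_measure_eq_AE)
    show "AE \<omega> in M. \<omega> \<in> {\<omega>\<in>space M. quiet (\<lambda>k. \<tau> k \<omega>) a b} \<longleftrightarrow>
        \<omega> \<in> {\<omega>\<in>space M. count_points \<tau> a b \<omega> = 0}"
      using poisson_points_regular[OF P]
    proof eventually_elim
      case (elim \<omega>)
      have "finite {k. a < \<tau> k \<omega> \<and> \<tau> k \<omega> \<le> b}"
        by (rule finite_subset[OF _ regular_points_finite[OF elim, of b]]) auto
      then show ?case by (auto simp: count_points_def quiet_def)
    qed
  qed (unfold quiet_def, measurable)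
  also have "\<dots> = measure (distr M (count_space UNIV) (count_points \<tau> a b)) {0}"
    by (subst measure_distr) (auto intro!: arg_cong[where f=prob])
  also have "\<dots> = pmf (poisson_pmf (r * (b - a))) 0"
    unfolding d by (simp add: measure_pmf_single)
  also have "\<dots> = exp (- r * (b - a))" using r ab' by simp
  finally show ?thesis .
qed

text \<open>
  Fubini's theorem for two independent random elements: the second one is resampled while the
  first one is held fixed.
\<close>

lemma (in prob_space) emeasure_indep_pair:
  assumes ind: "indep_var S U T V" and A: "A \<in> sets (S \<Otimes>\<^sub>M T)"
  shows "emeasure M {\<omega>\<in>space M. (U \<omega>, V \<omega>) \<in> A} =
    (\<integral>\<^sup>+\<omega>. emeasure M {\<omega>'\<in>space M. (U \<omega>, V \<omega>') \<in> A} \<partial>M)"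
proof -
  have [measurable]: "random_variable S U" "random_variable T V"
    using ind by (auto dest: indep_var_rv1 indep_var_rv2)
  note A [measurable]
  have eq: "distr M S U \<Otimes>\<^sub>M distr M T V = distr M (S \<Otimes>\<^sub>M T) (\<lambda>x. (U x, V x))"
    using ind indep_var_distribution_eq by blast
  interpret V: prob_space "distr M T V" by (rule prob_space_distr) simp
  have A': "A \<in> sets (distr M S U \<Otimes>\<^sub>M distr M T V)" using A by simp
  have A'': "A \<in> sets (S \<Otimes>\<^sub>M distr M T V)"
    using A by (simp cong: sets_pair_measure_cong)
  have "emeasure M {\<omega>\<in>space M. (U \<omega>, V \<omega>) \<in> A} = emeasure (distr M (S \<Otimes>\<^sub>M T) (\<lambda>x. (U x, V x))) A"
    by (subst emeasure_distr) (auto intro!: arg_cong[where f="emeasure M"])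
  also have "\<dots> = (\<integral>\<^sup>+u. emeasure (distr M T V) (Pair u -` A) \<partial>distr M S U)"
    unfolding eq[symmetric] by (rule V.emeasure_pair_measure_alt[OF A'])
  also have "\<dots> = (\<integral>\<^sup>+\<omega>. emeasure (distr M T V) (Pair (U \<omega>) -` A) \<partial>M)"
    using V.measurable_emeasure_Pair[OF A''] by (subst nn_integral_distr) auto
  also have "\<dots> = (\<integral>\<^sup>+\<omega>. emeasure M {\<omega>'\<in>space M. (U \<omega>, V \<omega>') \<in> A} \<partial>M)"
    using sets_Pair1[OF A]
    by (intro nn_integral_cong, subst emeasure_distr) (auto intro!: arg_cong[where f="emeasure M"])
  finally show ?thesis .
qed

text \<open>
  A point at \<open>c\<close> is a point in \<open>(c - e, c]\<close>, which has probability at most \<open>r e\<close>.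
\<close>

lemma (in prob_space) poisson_points_no_atom:
  assumes P: "poisson_points r \<tau>" and r: "0 < r" and c: "0 < c"
  shows "emeasure M {\<omega>\<in>space M. c = \<tau> k \<omega>} = 0"
proof -
  have [measurable]: "\<And>k. random_variable borel (\<tau> k)" using P by (simp add: poisson_points_def)
  have le: "prob {\<omega>\<in>space M. c = \<tau> k \<omega>} \<le> r * e" if e: "0 < e" "e \<le> c" for e
  proof -
    have meas: "{\<omega>\<in>space M. quiet (\<lambda>k. \<tau> k \<omega>) (c - e) c} \<in> events"
      unfolding quiet_def by measurable
    have "\<not> quiet (\<lambda>k. \<tau> k \<omega>) (c - e) c" if "c = \<tau> k \<omega>" for \<omega>
      using that e by (auto simp: quiet_def intro!: exI[of _ k])
    then have "prob {\<omega>\<in>space M. c = \<tau> k \<omega>} \<le> prob (space M - {\<omega>\<in>space M. quiet (\<lambda>k. \<tau> k \<omega>) (c - e) c})"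
      using meas by (intro finite_measure_mono) auto
    also have "\<dots> = 1 - exp (- (r * e))"
      using prob_compl[OF meas] prob_quiet[OF P r, of "c - e" c] e by simp
    also have "\<dots> \<le> r * e" using exp_ge_add_one_self[of "- (r * e)"] by simp
    finally show ?thesis .
  qed
  have "prob {\<omega>\<in>space M. c = \<tau> k \<omega>} \<le> 0"
  proof (rule field_le_epsilon)
    fix e :: real assume e: "0 < e"
    have "prob {\<omega>\<in>space M. c = \<tau> k \<omega>} \<le> r * min c (e / r)"
      using e c r by (intro le) auto
    also have "\<dots> \<le> r * (e / r)" using r by (intro mult_left_mono) auto
    finally show "prob {\<omega>\<in>space M. c = \<tau> k \<omega>} \<le> 0 + e" using r by simp
  qed
  then show ?thesis by (simp add: emeasure_eq_measure measure_le_0_iff)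
qed

section \<open>Jumps of the ranking process\<close>

context stochastic_ranking_process
begin

lemma measurable_points [measurable]:
  "i \<in> {1..N} \<Longrightarrow> (\<lambda>\<omega> k. \<tau> i k \<omega>) \<in> M \<rightarrow>\<^sub>M PiM UNIV (\<lambda>_. borel)"
  using indep unfolding indep_vars_def by blast

lemma AE_regular: "AE \<omega> in M. \<forall>i\<in>{1..N}. regular_points (\<lambda>k. \<tau> i k \<omega>)"
  using poisson poisson_points_regular by (intro AE_finite_allI) auto

text \<open>
  The points of item \<open>i\<close> being fixed, the independent item \<open>j\<close> hits none of these countably many
  times, because its points have no atoms.
\<close>

lemma AE_distinct_points:
  "AE \<omega> in M. \<forall>i\<in>{1..N}. \<forall>j\<in>{1..N}. i \<noteq> j \<longrightarrow> (\<forall>k l. \<tau> i k \<omega> \<noteq> \<tau> j l \<omega>)"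
proof -
  have "AE \<omega> in M. \<tau> i k \<omega> \<noteq> \<tau> j l \<omega>" if ij: "i \<in> {1..N}" "j \<in> {1..N}" "i \<noteq> j" for i j k l
  proof -
    let ?P = "PiM UNIV (\<lambda>_. borel) :: (nat \<Rightarrow> real) measure"
    note [measurable] = measurable_points[OF ij(1)] measurable_points[OF ij(2)]
    have ind: "indep_var (PiM {i} (\<lambda>_. ?P)) (\<lambda>\<omega>. restrict (\<lambda>i k. \<tau> i k \<omega>) {i})
        (PiM {j} (\<lambda>_. ?P)) (\<lambda>\<omega>. restrict (\<lambda>i k. \<tau> i k \<omega>) {j})"
      by (rule indep_var_restrict[OF indep]) (use ij in auto)
    define A where "A = {p \<in> space (PiM {i} (\<lambda>_. ?P) \<Otimes>\<^sub>M PiM {j} (\<lambda>_. ?P)). fst p i k = snd p j l}"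
    have A: "A \<in> sets (PiM {i} (\<lambda>_. ?P) \<Otimes>\<^sub>M PiM {j} (\<lambda>_. ?P))"
      unfolding A_def
      by (intro borel_measurable_eq measurable_compose[OF measurable_fst measurable_points_component]
          measurable_compose[OF measurable_snd measurable_points_component]) auto
    have memA: "(restrict (\<lambda>i k. \<tau> i k \<omega>) {i}, restrict (\<lambda>i k. \<tau> i k \<omega>') {j}) \<in> A \<longleftrightarrow>
        \<tau> i k \<omega> = \<tau> j l \<omega>'" if "\<omega> \<in> space M" "\<omega>' \<in> space M" for \<omega> \<omega>'
      unfolding A_def by (auto simp: space_pair_measure space_PiM)
    have "emeasure M {\<omega>\<in>space M. \<tau> i k \<omega> = \<tau> j l \<omega>} =
        emeasure M {\<omega>\<in>space M. (restrict (\<lambda>i k. \<tau> i k \<omega>) {i}, restrict (\<lambda>i k. \<tau> i k \<omega>) {j}) \<in> A}"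
      using memA by (intro arg_cong[where f="emeasure M"]) auto
    also have "\<dots> = (\<integral>\<^sup>+\<omega>. emeasure M {\<omega>'\<in>space M.
        (restrict (\<lambda>i k. \<tau> i k \<omega>) {i}, restrict (\<lambda>i k. \<tau> i k \<omega>') {j}) \<in> A} \<partial>M)"
      by (rule emeasure_indep_pair[OF ind A])
    also have "\<dots> = (\<integral>\<^sup>+\<omega>. emeasure M {\<omega>'\<in>space M. \<tau> i k \<omega> = \<tau> j l \<omega>'} \<partial>M)"
      using memA by (intro nn_integral_cong arg_cong[where f="emeasure M"]) auto
    also have "\<dots> = (\<integral>\<^sup>+\<omega>. 0 \<partial>M)"
    proof (rule nn_integral_cong_AE)
      show "AE \<omega> in M. emeasure M {\<omega>'\<in>space M. \<tau> i k \<omega> = \<tau> j l \<omega>'} = 0"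
        using AE_regular
      proof eventually_elim
        case (elim \<omega>)
        then have "0 < \<tau> i k \<omega>" using regular_points_pos ij(1) by blast
        then show ?case
          by (rule poisson_points_no_atom[OF poisson[OF ij(2)] rate_pos[OF ij(2)]])
      qed
    qed
    finally have z: "emeasure M {\<omega>\<in>space M. \<tau> i k \<omega> = \<tau> j l \<omega>} = 0" by simp
    have "random_variable borel (\<tau> i k)" "random_variable borel (\<tau> j l)"
      using poisson ij by (auto simp: poisson_points_def)
    then have [measurable]: "\<tau> i k \<in> borel_measurable M" "\<tau> j l \<in> borel_measurable M" by auto
    show ?thesis
      by (rule AE_I[OF _ z]) auto
  qed
  then show ?thesis
    by (intro AE_finite_allI) (auto simp: AE_all_countable)
qed

definition jump_time :: "real \<Rightarrow> nat \<Rightarrow> 'a \<Rightarrow> real" where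
  "jump_time t i \<omega> = next_jump (\<lambda>k. \<tau> i k \<omega>) t"

lemma measurable_jump_time [measurable]:
  "i \<in> {1..N} \<Longrightarrow> jump_time t i \<in> borel_measurable M"
  unfolding jump_time_def by measurable

lemma measurable_quiet_points [measurable]:
  "i \<in> {1..N} \<Longrightarrow> Measurable.pred M (\<lambda>\<omega>. quiet (\<lambda>k. \<tau> i k \<omega>) a b)"
  by measurable

lemma prob_quiet_item:
  "i \<in> {1..N} \<Longrightarrow> 0 \<le> a \<Longrightarrow> a \<le> b \<Longrightarrow>
    prob {\<omega>\<in>space M. quiet (\<lambda>k. \<tau> i k \<omega>) a b} = exp (- w i * (b - a))"
  by (rule prob_quiet[OF poisson rate_pos])

text \<open>
  No points in \<open>(a,t]\<close> and none in \<open>(t,v]\<close> is the same as no points in \<open>(a,v]\<close>.  So the void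
  probabilities alone show that the waiting time after \<open>t\<close> is independent of the event of no jump
  in \<open>(a,t]\<close>.
\<close>

lemma prob_quiet_jump_time_gt:
  assumes i: "i \<in> {1..N}" and t: "0 \<le> a" "a \<le> t" "t \<le> v"
  shows "prob {\<omega>\<in>space M. quiet (\<lambda>k. \<tau> i k \<omega>) a t \<and> v < jump_time t i \<omega>} = exp (- w i * (v - a))"
proof -
  note [measurable] = measurable_jump_time[OF i] measurable_quiet_points[OF i]
  have "prob {\<omega>\<in>space M. quiet (\<lambda>k. \<tau> i k \<omega>) a t \<and> v < jump_time t i \<omega>} =
      prob {\<omega>\<in>space M. quiet (\<lambda>k. \<tau> i k \<omega>) a v}"
  proof (rule finite_measure_eq_AE)
    show "AE \<omega> in M. \<omega> \<in> {\<omega>\<in>space M. quiet (\<lambda>k. \<tau> i k \<omega>) a t \<and> v < jump_time t i \<omega>} \<longleftrightarrow>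
        \<omega> \<in> {\<omega>\<in>space M. quiet (\<lambda>k. \<tau> i k \<omega>) a v}"
      using AE_regular
    proof eventually_elim
      case (elim \<omega>)
      have "v \<le> t \<Longrightarrow> quiet (\<lambda>k. \<tau> i k \<omega>) t v" by (auto simp: quiet_def)
      then show ?case
        using elim i t next_jump_gt_iff_quiet[of "\<lambda>k. \<tau> i k \<omega>" v t]
          quiet_append[OF t(2,3), of "\<lambda>k. \<tau> i k \<omega>"]
        by (auto simp: jump_time_def)
    qed
  qed auto
  then show ?thesis using prob_quiet_item[OF i, of a v] t by simp
qed


lemma prob_all_jump_time_gt:
  assumes J: "J \<subseteq> {1..N}" and u: "0 \<le> t" "t \<le> u"
  shows "prob {\<omega>\<in>space M. \<forall>j\<in>J. u < jump_time t j \<omega>} = exp (- (\<Sum>j\<in>J. w j) * (u - t))"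
proof (cases "J = {}")
  case True
  then show ?thesis by (simp add: prob_space)
next
  case False
  have fin: "finite J" using J finite_subset by blast
  have ind: "indep_vars (\<lambda>_. borel) (jump_time t) {1..N}"
    unfolding jump_time_def[abs_def]
    by (rule indep_vars_compose2[OF indep]) measurable
  have one: "prob (jump_time t j -` {u<..} \<inter> space M) = exp (- w j * (u - t))" if j: "j \<in> J" for j
  proof -
    have "jump_time t j -` {u<..} \<inter> space M =
        {\<omega>\<in>space M. quiet (\<lambda>k. \<tau> j k \<omega>) t t \<and> u < jump_time t j \<omega>}"
      by (auto simp: quiet_def)
    then show ?thesis using prob_quiet_jump_time_gt[of j t t u] j J u by auto
  qed
  have "{\<omega>\<in>space M. \<forall>j\<in>J. u < jump_time t j \<omega>} = (\<Inter>j\<in>J. jump_time t j -` {u<..} \<inter> space M)"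
    using False by auto
  then have "prob {\<omega>\<in>space M. \<forall>j\<in>J. u < jump_time t j \<omega>} =
      (\<Prod>j\<in>J. prob (jump_time t j -` {u<..} \<inter> space M))"
    using indep_varsD[OF ind False fin J, of "\<lambda>_. {u<..}"] by simp
  also have "\<dots> = (\<Prod>j\<in>J. exp (- w j * (u - t)))" using one by simp
  also have "\<dots> = exp (- (\<Sum>j\<in>J. w j) * (u - t))"
    by (simp add: exp_sum[OF fin, symmetric] sum_distrib_right sum_negf)
  finally show ?thesis .
qed

text \<open>
  Memorylessness.  The condition on the past is what makes the next request independent of the
  depth: the law obtained does not depend on \<open>a\<close>.
\<close>

lemma exponential_jump_time:
  assumes i: "i \<in> {1..N}" and t: "0 \<le> a" "a \<le> t"
  defines "B \<equiv> {\<omega>\<in>space M. quiet (\<lambda>k. \<tau> i k \<omega>) a t}"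
  shows "distributed (uniform_measure M B) lborel (\<lambda>\<omega>. jump_time t i \<omega> - t) (exponential_density (w i))"
proof -
  note [measurable] = measurable_jump_time[OF i] measurable_quiet_points[OF i]
  have B [measurable]: "B \<in> events" unfolding B_def by measurable
  have pB: "prob B = exp (- w i * (t - a))"
    unfolding B_def using prob_quiet_item[OF i] t by simp
  then have B0: "emeasure M B \<noteq> 0" "emeasure M B \<noteq> \<infinity>" by (auto simp: emeasure_eq_measure)
  then interpret Q: prob_space "uniform_measure M B" by (rule prob_space_uniform_measure)
  show "distributed (uniform_measure M B) lborel (\<lambda>\<omega>. jump_time t i \<omega> - t) (exponential_density (w i))"
    unfolding Q.exponential_distributed_iff[OF rate_pos[OF i]]
  proof (intro conjI allI impI)
    fix u :: real assume u: "0 \<le> u"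
    let ?G = "{\<omega>\<in>space M. quiet (\<lambda>k. \<tau> i k \<omega>) a t \<and> t + u < jump_time t i \<omega>}"
    have G: "?G \<in> events" by measurable
    have "B \<inter> {\<omega>\<in>space M. jump_time t i \<omega> - t \<le> u} = B - ?G"
      unfolding B_def by auto
    then have "prob (B \<inter> {\<omega>\<in>space M. jump_time t i \<omega> - t \<le> u}) = prob B - prob ?G"
      using finite_measure_Diff[OF B G] by (auto simp: B_def Collect_mono_iff)
    also have "prob ?G = exp (- w i * (t + u - a))"
      using prob_quiet_jump_time_gt[OF i t, of "t + u"] u by simp
    also have "\<dots> = prob B * exp (- u * w i)"
      unfolding pB exp_add[symmetric] by (simp add: algebra_simps)
    finally have "prob (B \<inter> {\<omega>\<in>space M. jump_time t i \<omega> - t \<le> u}) / prob B = 1 - exp (- u * w i)"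
      using pB by (simp add: field_simps)
    then show "measure (uniform_measure M B) {\<omega> \<in> space (uniform_measure M B). jump_time t i \<omega> - t \<le> u} =
        1 - exp (- u * w i)"
      using B0 by (subst measure_uniform_measure) auto
  qed simp
qed

abbreviation "total_rate \<equiv> (\<Sum>i\<in>{1..N}. w i)"

text \<open>
  An exponential race.  Given its own points, item \<open>i\<close> wins when all others, whose minimal waiting
  time is exponential with rate \<open>R\<close>, take longer; integrating \<open>e\<^bsup>-Ru\<^esup>\<close> against the conditional
  law \<open>w\<^sub>i e\<^bsup>-w\<^sub>i u\<^esup> du\<close> of the waiting time gives \<open>w\<^sub>i / (w\<^sub>i + R)\<close>.
\<close>

lemma prob_quiet_and_first:
  assumes i: "i \<in> {1..N}" and t: "0 \<le> a" "a \<le> t"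
  shows "prob {\<omega>\<in>space M. quiet (\<lambda>k. \<tau> i k \<omega>) a t \<and>
      (\<forall>j\<in>{1..N} - {i}. jump_time t i \<omega> < jump_time t j \<omega>)} =
    exp (- w i * (t - a)) * (w i / total_rate)"
proof -
  let ?J = "{1..N} - {i}"
  let ?P = "PiM UNIV (\<lambda>_. borel) :: (nat \<Rightarrow> real) measure"
  let ?S = "PiM {i} (\<lambda>_. ?P)" and ?T = "PiM ?J (\<lambda>_. ?P)"
  let ?U = "\<lambda>\<omega>. restrict (\<lambda>i k. \<tau> i k \<omega>) {i}" and ?V = "\<lambda>\<omega>. restrict (\<lambda>i k. \<tau> i k \<omega>) ?J"
  define R where "R = (\<Sum>j\<in>?J. w j)"
  have total: "total_rate = w i + R" unfolding R_def using i by (simp add: sum.remove)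
  have R0: "0 \<le> R" unfolding R_def using rate_pos by (intro sum_nonneg) (simp add: less_imp_le)
  have wi: "0 < w i" by (rule rate_pos[OF i])
  define B where "B = {\<omega>\<in>space M. quiet (\<lambda>k. \<tau> i k \<omega>) a t}"
  note [measurable] = measurable_jump_time[OF i] measurable_quiet_points[OF i]
  have B [measurable]: "B \<in> events" unfolding B_def by measurable
  have pB: "prob B = exp (- w i * (t - a))"
    unfolding B_def using prob_quiet_item[OF i] t by simp
  have ind: "indep_var ?S ?U ?T ?V" by (rule indep_var_restrict[OF indep]) (use i in auto)
  define A where "A = {p \<in> space (?S \<Otimes>\<^sub>M ?T). quiet (fst p i) a t \<and>
    (\<forall>j\<in>?J. next_jump (fst p i) t < next_jump (snd p j) t)}"
  have [measurable]: "(\<lambda>p. fst p i) \<in> ?S \<Otimes>\<^sub>M ?T \<rightarrow>\<^sub>M ?P"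
    by (rule measurable_compose[OF measurable_fst measurable_component_singleton]) simp
  have [measurable]: "(\<lambda>p. snd p j) \<in> ?S \<Otimes>\<^sub>M ?T \<rightarrow>\<^sub>M ?P" if "j \<in> ?J" for j
    by (rule measurable_compose[OF measurable_snd measurable_component_singleton[OF that]])
  have A: "A \<in> sets (?S \<Otimes>\<^sub>M ?T)" unfolding A_def by measurable
  have memA: "(?U \<omega>, ?V \<omega>') \<in> A \<longleftrightarrow> \<omega> \<in> B \<and> (\<forall>j\<in>?J. jump_time t i \<omega> < jump_time t j \<omega>')"
    if "\<omega> \<in> space M" "\<omega>' \<in> space M" for \<omega> \<omega>'
    using that unfolding A_def B_def by (auto simp: space_pair_measure space_PiM jump_time_def)
  have "emeasure M {\<omega>\<in>space M. quiet (\<lambda>k. \<tau> i k \<omega>) a t \<and>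
      (\<forall>j\<in>?J. jump_time t i \<omega> < jump_time t j \<omega>)} = emeasure M {\<omega>\<in>space M. (?U \<omega>, ?V \<omega>) \<in> A}"
    using memA by (intro arg_cong[where f="emeasure M"]) (auto simp: B_def)
  also have "\<dots> = (\<integral>\<^sup>+\<omega>. emeasure M {\<omega>'\<in>space M. (?U \<omega>, ?V \<omega>') \<in> A} \<partial>M)"
    by (rule emeasure_indep_pair[OF ind A])
  also have "\<dots> = (\<integral>\<^sup>+\<omega>. ennreal (exp (- R * (jump_time t i \<omega> - t))) * indicator B \<omega> \<partial>M)"
  proof (rule nn_integral_cong_AE)
    show "AE \<omega> in M. emeasure M {\<omega>'\<in>space M. (?U \<omega>, ?V \<omega>') \<in> A} =
        ennreal (exp (- R * (jump_time t i \<omega> - t))) * indicator B \<omega>"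
      using AE_regular AE_space
    proof eventually_elim
      case (elim \<omega>)
      then have gt: "t \<le> jump_time t i \<omega>"
        using next_jump_gt i by (simp add: jump_time_def less_imp_le)
      have "{\<omega>'\<in>space M. (?U \<omega>, ?V \<omega>') \<in> A} =
          (if \<omega> \<in> B then {\<omega>'\<in>space M. \<forall>j\<in>?J. jump_time t i \<omega> < jump_time t j \<omega>'} else {})"
        using memA elim by auto
      then show ?case
        using prob_all_jump_time_gt[of ?J t "jump_time t i \<omega>"] gt t
        by (auto simp: emeasure_eq_measure R_def)
    qed
  qed
  also have "\<dots> = emeasure M B * (\<integral>\<^sup>+\<omega>. ennreal (exp (- R * (jump_time t i \<omega> - t))) \<partial>uniform_measure M B)"
  proof -
    have "emeasure M B \<noteq> 0" "emeasure M B \<noteq> top" by (auto simp: emeasure_eq_measure pB)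
    then show ?thesis
      by (subst nn_integral_uniform_measure)
        (simp_all add: ennreal_times_divide mult.commute[of "emeasure M B"] ennreal_mult_divide_eq)
  qed
  also have "(\<integral>\<^sup>+\<omega>. ennreal (exp (- R * (jump_time t i \<omega> - t))) \<partial>uniform_measure M B) =
      (\<integral>\<^sup>+u. ennreal (exponential_density (w i) u) * ennreal (exp (- R * u)) \<partial>lborel)"
    by (rule distributed_nn_integral[symmetric])
      (use exponential_jump_time[OF i t] in \<open>auto simp: B_def\<close>)
  also have "\<dots> = (\<integral>\<^sup>+u. ennreal (w i / total_rate) * ennreal (exponential_density total_rate u) \<partial>lborel)"
  proof (rule nn_integral_cong)
    fix u :: real
    have "w i * exp (- u * w i) * exp (- R * u) = w i * exp (- u * total_rate)"
      unfolding total mult.assoc mult_exp_exp by (simp add: algebra_simps)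
    also have "\<dots> = w i / total_rate * (total_rate * exp (- u * total_rate))"
      using wi R0 total by simp
    finally show "ennreal (exponential_density (w i) u) * ennreal (exp (- R * u)) =
        ennreal (w i / total_rate) * ennreal (exponential_density total_rate u)"
      using wi R0 total by (auto simp: exponential_density_def ennreal_mult[symmetric])
  qed
  also have "\<dots> = ennreal (w i / total_rate) * (\<integral>\<^sup>+u. ennreal (exponential_density total_rate u) \<partial>lborel)"
    by (rule nn_integral_cmult) simp
  also have "(\<integral>\<^sup>+u. ennreal (exponential_density total_rate u) \<partial>lborel) = 1"
    using prob_space.emeasure_space_1[OF prob_space_exponential_density[of total_rate]] wi R0 total
    by (simp add: emeasure_density)
  finally show ?thesis
    using wi R0 total unfolding emeasure_eq_measure pB
    by (simp add: ennreal_mult[symmetric])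
qed

text \<open>
  The minimizer is chosen by an unspecified selection, which is measurable because it depends
  only on the finite set of all minimizers.
\<close>

lemma measurable_next_item [measurable]: "next_item N \<tau> t \<in> M \<rightarrow>\<^sub>M count_space UNIV"
proof -
  define A where "A \<omega> = {i\<in>{1..N}. \<forall>j\<in>{1..N}. \<not> jump_time t j \<omega> < jump_time t i \<omega>}" for \<omega>
  have "A \<in> M \<rightarrow>\<^sub>M count_space (Pow {1..N})"
  proof (subst measurable_count_space_eq2, simp, intro conjI ballI)
    show "A \<in> space M \<rightarrow> Pow {1..N}" by (auto simp: A_def)
    fix C assume C: "C \<in> Pow {1..N}"
    have "A -` {C} \<inter> space M =
        {\<omega>\<in>space M. \<forall>i\<in>{1..N}. i \<in> C \<longleftrightarrow> (\<forall>j\<in>{1..N}. \<not> jump_time t j \<omega> < jump_time t i \<omega>)}"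
      using C unfolding A_def by blast
    also have "\<dots> \<in> events" by measurable
    finally show "A -` {C} \<inter> space M \<in> events" .
  qed
  then have "(\<lambda>\<omega>. SOME i. i \<in> A \<omega>) \<in> M \<rightarrow>\<^sub>M count_space UNIV"
    by (rule measurable_compose) simp
  moreover have "next_item N \<tau> t = (\<lambda>\<omega>. SOME i. i \<in> A \<omega>)"
    unfolding fun_eq_iff next_item_def arg_min_on_def arg_min_def is_arg_min_def A_def jump_time_def
    by (intro allI arg_cong[where f=Eps]) auto
  ultimately show ?thesis by (simp only:)
qed

lemma next_item_mem: "1 \<le> N \<Longrightarrow> next_item N \<tau> t \<omega> \<in> {1..N}"
  unfolding next_item_def by (rule arg_min_if_finite(1)) auto

lemma next_item_eqI:
  assumes "i \<in> {1..N}" "\<forall>j\<in>{1..N} - {i}. jump_time t i \<omega> < jump_time t j \<omega>"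
  shows "next_item N \<tau> t \<omega> = i"
proof (rule ccontr)
  assume "next_item N \<tau> t \<omega> \<noteq> i"
  moreover have "next_item N \<tau> t \<omega> \<in> {1..N}" by (rule next_item_mem) (use assms(1) in simp)
  ultimately have "jump_time t i \<omega> < jump_time t (next_item N \<tau> t \<omega>) \<omega>" using assms(2) by simp
  then show False
    using arg_min_if_finite(2)[of "{1..N}" "\<lambda>i. jump_time t i \<omega>"] assms(1)
    by (auto simp: next_item_def jump_time_def)
qed

text \<open>
  A strict winner of the race is the next item.  The probabilities of a strict win add up to 1, so
  ties are null and the two events agree almost surely.
\<close>

lemma prob_next_item:
  assumes i: "i \<in> {1..N}" and t: "0 \<le> a" "a \<le> t"
  shows "prob {\<omega>\<in>space M. next_item N \<tau> t \<omega> = i \<and> quiet (\<lambda>k. \<tau> i k \<omega>) a t} =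
    exp (- w i * (t - a)) * (w i / total_rate)"
proof -
  have N: "1 \<le> N" using i by simp
  let ?F = "\<lambda>j \<omega>. \<forall>l\<in>{1..N} - {j}. jump_time t j \<omega> < jump_time t l \<omega>"
  have tpos: "0 < total_rate" using rate_pos N by (intro sum_pos) auto
  have [measurable]: "{\<omega>\<in>space M. ?F j \<omega>} \<in> events" if j: "j \<in> {1..N}" for j
  proof -
    note [measurable] = measurable_jump_time[OF j]
    show ?thesis by measurable
  qed
  have first: "prob {\<omega>\<in>space M. ?F j \<omega>} = w j / total_rate" if j: "j \<in> {1..N}" for j
    using prob_quiet_and_first[OF j, of t t] t by (simp add: quiet_def)
  have le: "prob {\<omega>\<in>space M. ?F j \<omega>} \<le> prob {\<omega>\<in>space M. next_item N \<tau> t \<omega> = j}" if j: "j \<in> {1..N}" for j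
    using next_item_eqI[OF j] by (intro finite_measure_mono) auto
  have "(\<Sum>j\<in>{1..N}. prob {\<omega>\<in>space M. next_item N \<tau> t \<omega> = j}) = prob (\<Union>j\<in>{1..N}. {\<omega>\<in>space M. next_item N \<tau> t \<omega> = j})"
    by (rule finite_measure_finite_Union[symmetric]) (auto simp: disjoint_family_on_def)
  also have "(\<Union>j\<in>{1..N}. {\<omega>\<in>space M. next_item N \<tau> t \<omega> = j}) = space M"
    using next_item_mem[OF N] by auto
  finally have sum1: "(\<Sum>j\<in>{1..N}. prob {\<omega>\<in>space M. next_item N \<tau> t \<omega> = j}) = 1" by (simp add: prob_space)
  have "(\<Sum>j\<in>{1..N}. prob {\<omega>\<in>space M. next_item N \<tau> t \<omega> = j} - prob {\<omega>\<in>space M. ?F j \<omega>}) = 0"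
    using sum1 first tpos by (simp add: sum_subtractf sum_divide_distrib[symmetric])
  then have "\<forall>j\<in>{1..N}. prob {\<omega>\<in>space M. next_item N \<tau> t \<omega> = j} - prob {\<omega>\<in>space M. ?F j \<omega>} = 0"
    by (subst (asm) sum_nonneg_eq_0_iff) (use le in auto)
  then have eq: "prob {\<omega>\<in>space M. next_item N \<tau> t \<omega> = i} = prob {\<omega>\<in>space M. ?F i \<omega>}"
    using i by auto
  have "AE \<omega> in M. next_item N \<tau> t \<omega> = i \<longleftrightarrow> ?F i \<omega>"
  proof -
    have "prob ({\<omega>\<in>space M. next_item N \<tau> t \<omega> = i} - {\<omega>\<in>space M. ?F i \<omega>}) = 0"
      using i next_item_eqI[OF i] eq by (subst finite_measure_Diff) auto
    then have "AE \<omega> in M. \<omega> \<notin> {\<omega>\<in>space M. next_item N \<tau> t \<omega> = i} - {\<omega>\<in>space M. ?F i \<omega>}"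
      using i by (intro AE_not_in) (auto simp: null_sets_def emeasure_eq_measure)
    then show ?thesis using AE_space
      by eventually_elim (use next_item_eqI[OF i] in auto)
  qed
  then have "prob {\<omega>\<in>space M. next_item N \<tau> t \<omega> = i \<and> quiet (\<lambda>k. \<tau> i k \<omega>) a t} =
      prob {\<omega>\<in>space M. quiet (\<lambda>k. \<tau> i k \<omega>) a t \<and> ?F i \<omega>}"
    using i measurable_quiet_points[OF i] by (intro finite_measure_eq_AE) auto
  then show ?thesis using prob_quiet_and_first[OF i t] by simp
qed

end

section \<open>Tail bounds for the search cost\<close>

lemma measurable_fst_borel [measurable]: "fst \<in> borel_measurable (borel :: (real \<times> real) measure)"
  and measurable_snd_borel [measurable]: "snd \<in> borel_measurable (borel :: (real \<times> real) measure)"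
  by (intro borel_measurable_continuous_onI continuous_intros)+

text \<open>
  The probability that an item with rate \<open>fst p\<close> and initial relative position \<open>snd p\<close> has depth at
  least \<open>r\<close> at time \<open>t\<close>.  For \<open>r \<le> 0\<close> it must not jump during \<open>(-r,t]\<close>, an interval of length \<open>t + r\<close>;
  for \<open>r > 0\<close> it must not jump during \<open>(0,t]\<close> and must have started at or beyond \<open>r\<close>.
\<close>

definition survival :: "real \<Rightarrow> real \<Rightarrow> real \<times> real \<Rightarrow> real" where
  "survival t r p = (if r \<le> snd p then exp (- fst p * (t + min 0 r)) else 0)"

lemma measurable_survival [measurable]: "survival t r \<in> borel_measurable borel"
  unfolding survival_def[abs_def] by measurable

lemma survival_nonneg [simp]: "0 \<le> survival t r p"
  by (simp add: survival_def)

context stochastic_ranking_process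
begin

text \<open>
  Item \<open>i\<close> has depth at least \<open>r\<close>.  As initial positions are nonnegative, for \<open>r \<le> 0\<close> this means
  that it does not jump during \<open>(-r,t]\<close>.
\<close>

definition deep :: "real \<Rightarrow> real \<Rightarrow> nat \<Rightarrow> 'a \<Rightarrow> bool" where
  "deep t r i \<omega> \<longleftrightarrow> r \<le> (real (x0 i) - 1) / real N \<and> quiet (\<lambda>k. \<tau> i k \<omega>) (max 0 (- r)) t"

abbreviation deep_prob :: "real \<Rightarrow> real \<Rightarrow> nat \<Rightarrow> real" where
  "deep_prob t r i \<equiv> survival t r (w i, (real (x0 i) - 1) / real N)"

lemma measurable_deep [measurable]:
  "i \<in> {1..N} \<Longrightarrow> Measurable.pred M (deep t r i)"
  unfolding deep_def[abs_def] by measurable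

lemma max_minus_eq: "max 0 (- r) = - min 0 (r::real)"
  by (simp add: max_def min_def)

lemma prob_deep:
  assumes "i \<in> {1..N}" "- t \<le> r" "0 \<le> t"
  shows "prob {\<omega>\<in>space M. deep t r i \<omega>} = deep_prob t r i"
proof (cases "r \<le> (real (x0 i) - 1) / real N")
  case True
  then show ?thesis
    using prob_quiet_item[OF assms(1), of "max 0 (- r)" t] assms
    by (simp add: deep_def survival_def max_minus_eq)
qed (simp add: deep_def survival_def)

text \<open>
  The depth of an item and the event that it is requested next are independent, so the requested item
  is deep with the rate-weighted average of the individual probabilities.
\<close>

lemma prob_next_item_deep:
  assumes N: "1 \<le> N" and t: "- t \<le> r" "0 \<le> t"
  shows "{\<omega>\<in>space M. deep t r (next_item N \<tau> t \<omega>) \<omega>} \<in> events"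
    and "prob {\<omega>\<in>space M. deep t r (next_item N \<tau> t \<omega>) \<omega>} =
      (\<Sum>i\<in>{1..N}. w i * deep_prob t r i) / total_rate"
proof -
  have eq: "{\<omega>\<in>space M. deep t r (next_item N \<tau> t \<omega>) \<omega>} =
      (\<Union>i\<in>{1..N}. {\<omega>\<in>space M. next_item N \<tau> t \<omega> = i \<and> deep t r i \<omega>})"
    using next_item_mem[OF N, of t] by auto
  have ev: "{\<omega>\<in>space M. next_item N \<tau> t \<omega> = i \<and> deep t r i \<omega>} \<in> events" if i: "i \<in> {1..N}" for i
  proof -
    note [measurable] = measurable_deep[OF i]
    show ?thesis by measurable
  qed
  show "{\<omega>\<in>space M. deep t r (next_item N \<tau> t \<omega>) \<omega>} \<in> events"
    unfolding eq using ev by (intro sets.finite_UN) auto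
  have "prob {\<omega>\<in>space M. deep t r (next_item N \<tau> t \<omega>) \<omega>} =
      (\<Sum>i\<in>{1..N}. prob {\<omega>\<in>space M. next_item N \<tau> t \<omega> = i \<and> deep t r i \<omega>})"
    unfolding eq using ev by (intro finite_measure_finite_Union) (auto simp: disjoint_family_on_def)
  also have "\<dots> = (\<Sum>i\<in>{1..N}. w i * deep_prob t r i / total_rate)"
  proof (rule sum.cong[OF refl])
    fix i assume i: "i \<in> {1..N}"
    show "prob {\<omega>\<in>space M. next_item N \<tau> t \<omega> = i \<and> deep t r i \<omega>} = w i * deep_prob t r i / total_rate"
    proof (cases "r \<le> (real (x0 i) - 1) / real N")
      case True
      then show ?thesis
        using prob_next_item[OF i, of "max 0 (- r)" t] t
        by (simp add: deep_def survival_def max_minus_eq mult.commute)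
    qed (simp add: deep_def survival_def)
  qed
  finally show "prob {\<omega>\<in>space M. deep t r (next_item N \<tau> t \<omega>) \<omega>} =
      (\<Sum>i\<in>{1..N}. w i * deep_prob t r i) / total_rate"
    by (simp add: sum_divide_distrib)
qed

abbreviation "deep_items t r \<omega> \<equiv> {i\<in>{1..N}. deep t r i \<omega>}"

lemma
  fixes d :: real
  assumes N: "1 \<le> N" and t: "- t \<le> r" "0 \<le> t" and d: "0 < d"
  shows deep_items_upper_tail: "prob {\<omega>\<in>space M. (\<Sum>i\<in>{1..N}. deep_prob t r i) + N * d \<le> card (deep_items t r \<omega>)} \<le> exp (- 2 * d\<^sup>2 * N)"
    and deep_items_lower_tail: "prob {\<omega>\<in>space M. card (deep_items t r \<omega>) \<le> (\<Sum>i\<in>{1..N}. deep_prob t r i) - N * d} \<le> exp (- 2 * d\<^sup>2 * N)"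
    and measurable_card_deep_items: "(\<lambda>\<omega>. real (card (deep_items t r \<omega>))) \<in> borel_measurable M"
proof -
  define Z where "Z i \<omega> = (if deep t r i \<omega> then 1 else 0 :: real)" for i \<omega>
  have Z_alt: "Z = (\<lambda>i \<omega>. (\<lambda>s. if r \<le> (real (x0 i) - 1) / real N \<and> quiet s (max 0 (- r)) t then 1 else 0)
      (\<lambda>k. \<tau> i k \<omega>))"
    by (simp add: Z_def deep_def fun_eq_iff)
  have ind: "indep_vars (\<lambda>_. borel) Z {1..N}"
    unfolding Z_alt by (rule indep_vars_compose2[OF indep]) measurable
  have EZ: "expectation (Z i) = deep_prob t r i" if i: "i \<in> {1..N}" for i
  proof -
    note [measurable] = measurable_deep[OF i]
    have "Z i = indicator {\<omega>. deep t r i \<omega>}" by (auto simp: Z_def fun_eq_iff)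
    then have "expectation (Z i) = prob ({\<omega>. deep t r i \<omega>} \<inter> space M)" by simp
    also have "{\<omega>. deep t r i \<omega>} \<inter> space M = {\<omega>\<in>space M. deep t r i \<omega>}" by auto
    finally show ?thesis using prob_deep[OF i t] by simp
  qed
  have Z01: "AE \<omega> in M. Z i \<omega> \<in> {0..1}" for i by (simp add: Z_def)
  interpret H: Hoeffding_ineq M "{1..N}" Z "\<lambda>_. 0" "\<lambda>_. 1" "\<Sum>i\<in>{1..N}. expectation (Z i)"
    by unfold_locales (use ind Z01 in simp_all)
  have mean: "(\<Sum>i\<in>{1..N}. expectation (Z i)) = (\<Sum>i\<in>{1..N}. deep_prob t r i)"
    using EZ by (intro sum.cong) auto
  have sumZ: "(\<Sum>i\<in>{1..N}. Z i \<omega>) = card (deep_items t r \<omega>)" for \<omega>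
    unfolding Z_def by (simp add: sum.If_cases Int_def)
  have pos: "0 < (\<Sum>i\<in>{1..N}. (1 - 0 :: real)\<^sup>2)" using N by simp
  have ex: "- 2 * (N * d)\<^sup>2 / (\<Sum>i\<in>{1..N}. (1 - 0 :: real)\<^sup>2) = - 2 * d\<^sup>2 * N"
    using N by (simp add: power2_eq_square)
  show "prob {\<omega>\<in>space M. (\<Sum>i\<in>{1..N}. deep_prob t r i) + N * d \<le> card (deep_items t r \<omega>)} \<le> exp (- 2 * d\<^sup>2 * N)"
    using H.Hoeffding_ineq_ge[of "N * d"] d pos unfolding sumZ ex mean by simp
  show "prob {\<omega>\<in>space M. card (deep_items t r \<omega>) \<le> (\<Sum>i\<in>{1..N}. deep_prob t r i) - N * d} \<le> exp (- 2 * d\<^sup>2 * N)"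
    using H.Hoeffding_ineq_le[of "N * d"] d pos unfolding sumZ ex mean by simp
  show "(\<lambda>\<omega>. real (card (deep_items t r \<omega>))) \<in> borel_measurable M"
    unfolding sumZ[symmetric] using H.random_variable by (intro borel_measurable_sum) auto
qed

text \<open>
  The items that are not deep lead the queue at time \<open>t\<close>.  If \<open>r \<le> 0\<close>, start at time \<open>-r\<close> from the
  empty set; if \<open>r > 0\<close>, start at time 0 from the items whose relative position is below \<open>r\<close>, which
  occupy the first \<open>\<lceil>r N\<rceil>\<close> positions.  All items that jump afterwards are added.
\<close>

lemma position_iff_deep:
  assumes N: "1 \<le> N" and t: "- t \<le> r" "0 \<le> t"
  shows "AE \<omega> in M. \<forall>i\<in>{1..N}. deep t r i \<omega> \<longleftrightarrow> N - card (deep_items t r \<omega>) < X i t \<omega>"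
  using path AE_regular AE_distinct_points
proof eventually_elim
  case (elim \<omega>)
  let ?s = "\<lambda>i k. \<tau> i k \<omega>" and ?x = "\<lambda>i t. X i t \<omega>"
  define a where "a = max 0 (- r)"
  define m where "m = nat \<lceil>r * N\<rceil>"
  define S where "S = {i\<in>{1..N}. x0 i \<le> m}"
  have a: "0 \<le> a" "a \<le> t" using t by (auto simp: a_def)
  have fin: "finite (range (?s j) \<inter> {0<..T})" if "j \<in> {1..N}" for j T
  proof -
    have sub: "range (?s j) \<inter> {0<..T} \<subseteq> ?s j ` {k. ?s j k \<le> T}" by auto
    have "regular_points (?s j)" using elim(2) that by blast
    then show ?thesis
      by (intro finite_subset[OF sub] finite_imageI regular_points_finite)
  qed
  have disj: "range (?s i) \<inter> range (?s j) = {}" if "i \<in> {1..N}" "j \<in> {1..N}" "i \<noteq> j" for i j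
    using elim(3) that by blast
  have init: "?x i 0 = x0 i" if "i \<in> {1..N}" for i
    using elim(1) that unfolding move_to_front_path_def by blast
  have "queue N x0"
    using initial_permutation bij_betw_apply[OF initial_permutation]
    by (auto simp: queue_def bij_betw_def)
  then have q0: "queue N (\<lambda>i. ?x i 0)" using queue_cong[of N "\<lambda>i. ?x i 0" x0] init by blast
  have l0: "leading N (\<lambda>i. ?x i 0) S"
    unfolding S_def
    using leading_initial[OF initial_permutation, of m] leading_cong[of N "\<lambda>i. ?x i 0" x0] init by blast
  have along: "queue N (\<lambda>i. ?x i d) \<and> leading N (\<lambda>i. ?x i d) (S \<union> {j\<in>{1..N}. range (?s j) \<inter> {c<..d} \<noteq> {}})"
    if "0 \<le> c" "queue N (\<lambda>i. ?x i c)" "leading N (\<lambda>i. ?x i c) S" "c \<le> d" for c d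
    by (rule leading_along_path[OF elim(1)]) (use fin disj that in blast)+
  have qa: "queue N (\<lambda>i. ?x i a)" using along[OF _ q0 l0] a by simp
  have la: "leading N (\<lambda>i. ?x i a) S"
  proof (cases "r \<le> 0")
    case True
    then have "r * N \<le> 0" by (simp add: mult_nonpos_nonneg)
    then have "m = 0" by (simp add: m_def)
    then have "S = {}" using bij_betw_apply[OF initial_permutation] by (force simp: S_def)
    then show ?thesis using qa by (auto simp: leading_def queue_def)
  next
    case False
    then show ?thesis using l0 by (simp add: a_def)
  qed
  define L where "L = deep_items t r \<omega>"
  have early: "x0 i \<le> m \<longleftrightarrow> \<not> r \<le> (real (x0 i) - 1) / N" if i: "i \<in> {1..N}" for i
  proof -
    have "1 \<le> x0 i" using bij_betw_apply[OF initial_permutation i] by simp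
    then have "x0 i \<le> m \<longleftrightarrow> int (x0 i) \<le> \<lceil>r * N\<rceil>" unfolding m_def by linarith
    also have "\<dots> \<longleftrightarrow> real (x0 i) - 1 < r * N" by linarith
    also have "\<dots> \<longleftrightarrow> \<not> r \<le> (real (x0 i) - 1) / N" using N by (simp add: field_simps not_le)
    finally show ?thesis .
  qed
  have "S \<union> {j\<in>{1..N}. range (?s j) \<inter> {a<..t} \<noteq> {}} = {1..N} - L"
    unfolding S_def L_def deep_def a_def[symmetric] quiet_iff_disjoint using early by blast
  then have lead: "leading N (\<lambda>i. ?x i t) ({1..N} - L)"
    using along[OF a(1) qa la a(2)] by simp
  have "L \<subseteq> {1..N}" by (auto simp: L_def)
  then have card: "card ({1..N} - L) = N - card L" by (simp add: card_Diff_subset finite_subset)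
  have "deep t r i \<omega> \<longleftrightarrow> N - card L < X i t \<omega>" if i: "i \<in> {1..N}" for i
  proof (cases "i \<in> L")
    case True
    then have "N - card L < X i t \<omega>" using lead i unfolding leading_def card by auto
    then show ?thesis using True by (simp add: L_def)
  next
    case False
    then have "X i t \<omega> \<le> N - card L" using lead i unfolding leading_def card by auto
    then show ?thesis using False i by (simp add: L_def)
  qed
  then show ?case by (simp add: L_def)
qed

lemma measurable_search_cost:
  assumes N: "1 \<le> N" and t: "0 \<le> t"
  shows "{\<omega>\<in>space M. x < real (search_cost N \<tau> X t \<omega>) / real N} \<in> events"
proof -
  have "{\<omega>\<in>space M. x < real (search_cost N \<tau> X t \<omega>) / real N} =
      (\<Union>i\<in>{1..N}. {\<omega>\<in>space M. next_item N \<tau> t \<omega> = i \<and> x < real (X i t \<omega>) / real N})"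
    using next_item_mem[OF N, of t] by (auto simp: search_cost_def)
  also have "\<dots> \<in> events"
  proof (rule sets.finite_UN)
    fix i assume i: "i \<in> {1..N}"
    note [measurable] = random_position[OF i t]
    show "{\<omega>\<in>space M. next_item N \<tau> t \<omega> = i \<and> x < real (X i t \<omega>) / real N} \<in> events"
      by measurable
  qed simp
  finally show ?thesis .
qed

text \<open>
  If the number of items that are not deep is at least \<open>x N\<close>, a deep next item costs more than \<open>x N\<close>;
  if it is at most \<open>x N\<close>, a cost above \<open>x N\<close> forces the next item to be deep.  That number deviates
  from its mean \<open>N - A\<close> by \<open>d N\<close> with exponentially small probability.
\<close>

lemma
  fixes d x :: real
  assumes N: "1 \<le> N" and t: "- t \<le> r" "0 \<le> t" and d: "0 < d"
  defines "q \<equiv> (\<Sum>i\<in>{1..N}. w i * deep_prob t r i) / total_rate"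
    and "A \<equiv> (\<Sum>i\<in>{1..N}. deep_prob t r i)"
    and "p \<equiv> prob {\<omega>\<in>space M. x < real (search_cost N \<tau> X t \<omega>) / real N}"
  shows search_cost_tail_lower: "x \<le> 1 - A / N - d \<Longrightarrow> q - exp (- 2 * d\<^sup>2 * N) \<le> p"
    and search_cost_tail_upper: "1 - A / N + d \<le> x \<Longrightarrow> p \<le> q + exp (- 2 * d\<^sup>2 * N)"
proof -
  let ?C = "{\<omega>\<in>space M. x < real (search_cost N \<tau> X t \<omega>) / real N}"
  let ?L = "{\<omega>\<in>space M. deep t r (next_item N \<tau> t \<omega>) \<omega>}"
  let ?hi = "{\<omega>\<in>space M. A + N * d \<le> card (deep_items t r \<omega>)}"
  let ?lo = "{\<omega>\<in>space M. card (deep_items t r \<omega>) \<le> A - N * d}"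
  note C = measurable_search_cost[OF N t(2), of x]
  note L = prob_next_item_deep(1)[OF N t]
  have qL: "prob ?L = q" unfolding q_def by (rule prob_next_item_deep(2)[OF N t])
  note [measurable] = measurable_card_deep_items[OF N t d]
  have hi: "?hi \<in> events" and lo: "?lo \<in> events" by measurable
  have hi_le: "prob ?hi \<le> exp (- 2 * d\<^sup>2 * N)" and lo_le: "prob ?lo \<le> exp (- 2 * d\<^sup>2 * N)"
    using deep_items_upper_tail[OF N t d] deep_items_lower_tail[OF N t d] unfolding A_def by auto
  have Npos: "0 < real N" using N by simp
  have card_le: "card (deep_items t r \<omega>) \<le> N" for \<omega>
  proof -
    have "card (deep_items t r \<omega>) \<le> card {1..N}" by (rule card_mono) auto
    then show ?thesis by simp
  qed
  { assume x: "x \<le> 1 - A / N - d"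
    have "AE \<omega> in M. \<omega> \<in> ?L \<longrightarrow> \<omega> \<in> ?C \<union> ?hi"
      using position_iff_deep[OF N t] AE_space
    proof eventually_elim
      case (elim \<omega>)
      let ?i = "next_item N \<tau> t \<omega>"
      show ?case
      proof (intro impI, rule ccontr)
        assume l: "\<omega> \<in> ?L" and n: "\<omega> \<notin> ?C \<union> ?hi"
        have "N - card (deep_items t r \<omega>) < X ?i t \<omega>"
          using elim l next_item_mem[OF N] by auto
        moreover have "card (deep_items t r \<omega>) < A + N * d" using n elim by auto
        moreover have "x * N \<le> N - A - N * d"
          using mult_right_mono[OF x, of N] Npos by (simp add: algebra_simps)
        ultimately have "x * N < X ?i t \<omega>" using card_le[of \<omega>] by linarith
        then have "x < X ?i t \<omega> / N" using Npos by (simp add: field_simps)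
        then show False using n elim by (auto simp: search_cost_def)
      qed
    qed
    then have "prob ?L \<le> prob (?C \<union> ?hi)" by (rule finite_measure_mono_AE) (use C hi in auto)
    also have "\<dots> \<le> prob ?C + prob ?hi" by (rule measure_subadditive) (use C hi in auto)
    finally show "q - exp (- 2 * d\<^sup>2 * N) \<le> p" using hi_le qL by (simp add: p_def) }
  { assume x: "1 - A / N + d \<le> x"
    have "AE \<omega> in M. \<omega> \<in> ?C \<longrightarrow> \<omega> \<in> ?L \<union> ?lo"
      using position_iff_deep[OF N t] AE_space
    proof eventually_elim
      case (elim \<omega>)
      let ?i = "next_item N \<tau> t \<omega>"
      show ?case
      proof (intro impI, rule ccontr)
        assume l: "\<omega> \<in> ?C" and n: "\<omega> \<notin> ?L \<union> ?lo"
        have "X ?i t \<omega> \<le> N - card (deep_items t r \<omega>)"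
          using elim n next_item_mem[OF N] by (auto simp: not_less[symmetric])
        moreover have "A - N * d < card (deep_items t r \<omega>)" using n elim by auto
        moreover have "N - A + N * d \<le> x * N"
          using mult_right_mono[OF x, of N] Npos by (simp add: algebra_simps)
        ultimately have "X ?i t \<omega> < x * N" using card_le[of \<omega>] by linarith
        then have "X ?i t \<omega> / N < x" using Npos by (simp add: field_simps)
        then show False using l by (auto simp: search_cost_def)
      qed
    qed
    then have "prob ?C \<le> prob (?L \<union> ?lo)" by (rule finite_measure_mono_AE) (use L lo in auto)
    also have "\<dots> \<le> prob ?L + prob ?lo" by (rule measure_subadditive) (use L lo in auto)
    finally show "p \<le> q + exp (- 2 * d\<^sup>2 * N)" using lo_le qL by (simp add: p_def) }
qed

end

section \<open>The limit law of the depth\<close>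

locale ranking_limit =
  fixes lam :: "real measure" and mu0 :: "(real \<times> real) measure"
    and K :: "real \<Rightarrow> real measure" and t :: real
  assumes lam: "distribution_on {0..} lam" "measure lam {0} = 0" "integrable lam (\<lambda>v. v)"
    and mu0: "distribution_on ({0..} \<times> {0..<1}) mu0"
    and dis: "disintegrates mu0 K"
    and marginal: "distr mu0 borel fst = lam"
    and t: "0 \<le> t"
begin

sublocale lam: real_distribution lam
  using lam(1) unfolding distribution_on_def real_distribution_def real_distribution_axioms_def by blast

sublocale mu0: prob_space mu0
  using mu0 unfolding distribution_on_def by blast

lemma sets_initial_limit [measurable_cong, simp]: "sets mu0 = sets borel"
  using mu0 unfolding distribution_on_def by blast

lemma measurable_fst_mu0: "f \<in> borel \<rightarrow>\<^sub>M Z \<Longrightarrow> (\<lambda>p. f (fst p)) \<in> mu0 \<rightarrow>\<^sub>M Z"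
  using measurable_compose[OF measurable_fst_borel] measurable_cong_sets[OF sets_initial_limit refl] by blast

lemma measurable_snd_mu0: "f \<in> borel \<rightarrow>\<^sub>M Z \<Longrightarrow> (\<lambda>p. f (snd p)) \<in> mu0 \<rightarrow>\<^sub>M Z"
  using measurable_compose[OF measurable_snd_borel] measurable_cong_sets[OF sets_initial_limit refl] by blast

lemma AE_initial_limit: "AE p in mu0. 0 \<le> fst p \<and> 0 \<le> snd p \<and> snd p < 1"
proof -
  have "AE p in mu0. p \<in> {0..} \<times> {0..<1}" using mu0 unfolding distribution_on_def by blast
  then show ?thesis by eventually_elim auto
qed

lemma AE_rate_pos: "AE v in lam. 0 < v"
proof -
  have "AE v in lam. v \<in> {0..}" using lam(1) unfolding distribution_on_def by blast
  moreover have "AE v in lam. v \<noteq> 0"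
    by (rule AE_I[of _ _ "{0}"]) (auto simp: lam.emeasure_eq_measure lam(2))
  ultimately show ?thesis by eventually_elim auto
qed

lemma nn_integral_lam: "f \<in> borel_measurable borel \<Longrightarrow> (\<integral>\<^sup>+v. f v \<partial>lam) = (\<integral>\<^sup>+p. f (fst p) \<partial>mu0)"
proof -
  assume f: "f \<in> borel_measurable borel"
  have "(\<integral>\<^sup>+v. f v \<partial>distr mu0 borel fst) = (\<integral>\<^sup>+p. f (fst p) \<partial>mu0)"
    by (rule nn_integral_distr) (use f in measurable)
  then show ?thesis unfolding marginal .
qed

lemma kernel_measurable [measurable]: "K \<in> restrict_space borel {0..<1} \<rightarrow>\<^sub>M subprob_algebra borel"
  using dis unfolding disintegrates_def by blast

lemma sets_kernel: "y \<in> {0..<1} \<Longrightarrow> sets (K y) = sets borel"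
  using subprob_measurableD(2)[OF kernel_measurable, of y] by (simp add: space_restrict_space)

lemma measurable_kernel_integral:
  assumes "a \<in> borel_measurable borel"
  shows "(\<lambda>y. \<integral>\<^sup>+v. a v \<partial>K y) \<in> borel_measurable (restrict_space borel {0..<1})"
  by (rule measurable_compose[OF kernel_measurable nn_integral_measurable_subprob_algebra[OF assms]])

lemma measurable_kernel_integral_indicator:
  assumes "a \<in> borel_measurable borel" "B \<in> sets borel" "B \<subseteq> {0..<1}"
  shows "(\<lambda>y. (\<integral>\<^sup>+v. a v \<partial>K y) * indicator B y) \<in> borel_measurable lborel"
proof -
  have "(\<lambda>y. (\<integral>\<^sup>+v. a v \<partial>K y) * indicator {0..<1} y * indicator B y) \<in> borel_measurable borel"
  proof (rule borel_measurable_times_ennreal)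
    show "(\<lambda>y. (\<integral>\<^sup>+v. a v \<partial>K y) * indicator {0..<1} y) \<in> borel_measurable borel"
      using measurable_kernel_integral[OF assms(1)]
      by (simp add: borel_measurable_restrict_space_iff_ennreal)
  qed (use assms(2) in simp)
  moreover have "(\<lambda>y. (\<integral>\<^sup>+v. a v \<partial>K y) * indicator {0..<1} y * indicator B y) =
      (\<lambda>y. (\<integral>\<^sup>+v. a v \<partial>K y) * indicator B y)"
    using assms(3) by (auto simp: fun_eq_iff split: split_indicator)
  ultimately show ?thesis by simp
qed

text \<open>
  The definition of a disintegration speaks of rectangles; this extends it from the indicator of
  a set of rates to a nonnegative function of the rate.
\<close>

lemma nn_integral_disintegrate:
  assumes a: "a \<in> borel_measurable borel" and B: "B \<in> sets borel" "B \<subseteq> {0..<1}"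
  shows "(\<integral>\<^sup>+p. a (fst p) * indicator B (snd p) \<partial>mu0) =
    (\<integral>\<^sup>+y. (\<integral>\<^sup>+v. a v \<partial>K y) * indicator B y \<partial>lborel)"
  using a
proof (induction rule: borel_measurable_induct)
  case (cong f g)
  have "f = g" using cong(3) by auto
  then show ?case using cong by simp
next
  case (set A)
  have "(\<integral>\<^sup>+p. indicator A (fst p) * indicator B (snd p) \<partial>mu0) = emeasure mu0 (A \<times> B)"
  proof -
    have "A \<times> B \<in> sets mu0" using set B by (simp add: borel_prod[symmetric])
    then have "emeasure mu0 (A \<times> B) = (\<integral>\<^sup>+p. indicator (A \<times> B) p \<partial>mu0)" by simp
    then show ?thesis by (simp add: indicator_times)
  qed
  also have "\<dots> = (\<integral>\<^sup>+y. emeasure (K y) A * indicator (B \<inter> {0..<1}) y \<partial>lborel)"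
    using dis set B unfolding disintegrates_def by blast
  also have "\<dots> = (\<integral>\<^sup>+y. (\<integral>\<^sup>+v. indicator A v \<partial>K y) * indicator B y \<partial>lborel)"
  proof (rule nn_integral_cong)
    fix y
    show "emeasure (K y) A * indicator (B \<inter> {0..<1}) y = (\<integral>\<^sup>+v. indicator A v \<partial>K y) * indicator B y"
    proof (cases "y \<in> B")
      case True
      then have "y \<in> {0..<1}" using B by blast
      then have "(\<integral>\<^sup>+v. indicator A v \<partial>K y) = emeasure (K y) A" using set by (simp add: sets_kernel)
      then show ?thesis using True \<open>y \<in> {0..<1}\<close> by simp
    qed simp
  qed
  finally show ?case .
next
  case (mult f c)
  have "(\<integral>\<^sup>+p. c * f (fst p) * indicator B (snd p) \<partial>mu0) = c * (\<integral>\<^sup>+p. f (fst p) * indicator B (snd p) \<partial>mu0)"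
    using B(1) mult(2) unfolding mult.assoc
    by (intro nn_integral_cmult borel_measurable_times_ennreal measurable_fst_mu0 measurable_snd_mu0) auto
  also have "\<dots> = (\<integral>\<^sup>+y. c * ((\<integral>\<^sup>+v. f v \<partial>K y) * indicator B y) \<partial>lborel)"
    unfolding mult.IH by (rule nn_integral_cmult[symmetric]) (rule measurable_kernel_integral_indicator[OF mult(2) B])
  also have "\<dots> = (\<integral>\<^sup>+y. (\<integral>\<^sup>+v. c * f v \<partial>K y) * indicator B y \<partial>lborel)"
  proof (rule nn_integral_cong)
    fix y
    show "c * ((\<integral>\<^sup>+v. f v \<partial>K y) * indicator B y) = (\<integral>\<^sup>+v. c * f v \<partial>K y) * indicator B y"
    proof (cases "y \<in> B")
      case True
      then have "f \<in> borel_measurable (K y)" using B mult(2) sets_kernel[of y] by (auto cong: measurable_cong_sets)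
      then show ?thesis using True by (simp add: nn_integral_cmult)
    qed simp
  qed
  finally show ?case .
next
  case (add f g)
  have "(\<integral>\<^sup>+p. (g (fst p) + f (fst p)) * indicator B (snd p) \<partial>mu0) =
      (\<integral>\<^sup>+p. g (fst p) * indicator B (snd p) \<partial>mu0) + (\<integral>\<^sup>+p. f (fst p) * indicator B (snd p) \<partial>mu0)"
    using B(1) add(1,3) unfolding distrib_right
    by (intro nn_integral_add borel_measurable_times_ennreal measurable_fst_mu0 measurable_snd_mu0) auto
  also have "\<dots> = (\<integral>\<^sup>+y. (\<integral>\<^sup>+v. g v \<partial>K y) * indicator B y + (\<integral>\<^sup>+v. f v \<partial>K y) * indicator B y \<partial>lborel)"
    unfolding add.IH by (rule nn_integral_add[symmetric]) (rule measurable_kernel_integral_indicator[OF _ B], fact)+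
  also have "\<dots> = (\<integral>\<^sup>+y. (\<integral>\<^sup>+v. g v + f v \<partial>K y) * indicator B y \<partial>lborel)"
  proof (rule nn_integral_cong)
    fix y
    show "(\<integral>\<^sup>+v. g v \<partial>K y) * indicator B y + (\<integral>\<^sup>+v. f v \<partial>K y) * indicator B y = (\<integral>\<^sup>+v. g v + f v \<partial>K y) * indicator B y"
    proof (cases "y \<in> B")
      case True
      then have "f \<in> borel_measurable (K y)" "g \<in> borel_measurable (K y)"
        using B add(1,3) sets_kernel[of y] by (auto cong: measurable_cong_sets)
      then show ?thesis using True by (simp add: nn_integral_add)
    qed simp
  qed
  finally show ?case .
next
  case (seq U)
  have "(\<integral>\<^sup>+p. (SUP i. U i) (fst p) * indicator B (snd p) \<partial>mu0) = (\<integral>\<^sup>+p. (SUP i. U i (fst p) * indicator B (snd p)) \<partial>mu0)"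
    by (simp add: SUP_mult_right_ennreal image_comp)
  also have "\<dots> = (SUP i. \<integral>\<^sup>+p. U i (fst p) * indicator B (snd p) \<partial>mu0)"
    using B(1) seq(1,3)
    by (intro nn_integral_monotone_convergence_SUP borel_measurable_times_ennreal
        measurable_fst_mu0 measurable_snd_mu0)
      (auto simp: incseq_def le_fun_def intro!: mult_right_mono)
  also have "\<dots> = (SUP i. \<integral>\<^sup>+y. (\<integral>\<^sup>+v. U i v \<partial>K y) * indicator B y \<partial>lborel)"
    unfolding seq.IH ..
  also have "\<dots> = (\<integral>\<^sup>+y. (SUP i. (\<integral>\<^sup>+v. U i v \<partial>K y) * indicator B y) \<partial>lborel)"
    using seq(3) by (intro nn_integral_monotone_convergence_SUP[symmetric] measurable_kernel_integral_indicator seq B)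
      (auto simp: incseq_def le_fun_def intro!: mult_right_mono nn_integral_mono)
  also have "\<dots> = (\<integral>\<^sup>+y. (\<integral>\<^sup>+v. (SUP i. U i) v \<partial>K y) * indicator B y \<partial>lborel)"
  proof (rule nn_integral_cong)
    fix y
    show "(SUP i. (\<integral>\<^sup>+v. U i v \<partial>K y) * indicator B y) = (\<integral>\<^sup>+v. (SUP i. U i) v \<partial>K y) * indicator B y"
    proof (cases "y \<in> B")
      case True
      then have "U i \<in> borel_measurable (K y)" for i
        using B seq(1)[of i] sets_kernel[of y] by (auto cong: measurable_cong_sets)
      then have "(\<integral>\<^sup>+v. (SUP i. U i v) \<partial>K y) = (SUP i. \<integral>\<^sup>+v. U i v \<partial>K y)"
        using seq(3) by (intro nn_integral_monotone_convergence_SUP) auto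
      then show ?thesis using True by (simp add: image_comp)
    qed simp
  qed
  finally show ?case .
qed

end

text \<open>
  An item of rate \<open>v\<close> has depth density \<open>v e\<^bsup>-v(t+s)\<^esup>\<close> at negative depth \<open>s\<close>; this is its integral.
\<close>

lemma nn_integral_exp_decay:
  assumes "0 \<le> c" "0 \<le> v" "r \<le> 0"
  shows "(\<integral>\<^sup>+s. ennreal (c * (v * exp (- v * (t + s)))) * indicator {r..<0} s \<partial>lborel) =
    ennreal (c * (exp (- v * (t + r)) - exp (- v * t)))"
proof -
  have "(\<integral>\<^sup>+s. ennreal (c * (v * exp (- v * (t + s)))) * indicator {r..<0} s \<partial>lborel) =
      (\<integral>\<^sup>+s. ennreal (c * (v * exp (- v * (t + s)))) * indicator {r..0} s \<partial>lborel)"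
    using AE_lborel_singleton[of "0::real"]
    by (intro nn_integral_cong_AE) (auto split: split_indicator)
  also have "\<dots> = ennreal ((- c * exp (- v * (t + 0))) - (- c * exp (- v * (t + r))))"
    using assms
    by (intro nn_integral_FTC_Icc[where F = "\<lambda>s. - c * exp (- v * (t + s))"])
      (auto intro!: derivative_eq_intros)
  finally show ?thesis by (simp add: algebra_simps)
qed

context ranking_limit
begin

text \<open>
  The limit density of the depth, with every item weighted by \<open>f\<close> of its rate.  At a depth \<open>r < 0\<close> it
  counts the items with last jump at time \<open>-r\<close>, at a depth \<open>r \<ge> 0\<close> those which started at \<open>r\<close> and have
  not jumped.  Up to normalization these are the two cases in the definition of \<open>\<mu>\<^bsub>y,t\<^esub>\<close>.
\<close>

definition depth_density :: "(real \<Rightarrow> real) \<Rightarrow> real \<Rightarrow> ennreal" where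
  "depth_density f r =
     (if r < 0 then \<integral>\<^sup>+v. ennreal (f v * (v * exp (- v * (t + r)))) \<partial>lam
      else \<integral>\<^sup>+v. ennreal (f v * exp (- v * t)) \<partial>K r) * indicator {- t..<1} r"

definition depth_measure :: "(real \<Rightarrow> real) \<Rightarrow> real measure" where
  "depth_measure f = density lborel (depth_density f)"

definition depth_tail :: "(real \<Rightarrow> real) \<Rightarrow> real \<Rightarrow> real" where
  "depth_tail f r = measure (depth_measure f) {r..}"

lemma measurable_depth_density [measurable]:
  assumes [measurable]: "f \<in> borel_measurable borel"
  shows "depth_density f \<in> borel_measurable borel"
proof -
  have "depth_density f = (\<lambda>r. (\<integral>\<^sup>+v. ennreal (f v * (v * exp (- v * (t + r)))) \<partial>lam) * indicator {- t..<0} r +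
      (\<integral>\<^sup>+v. ennreal (f v * exp (- v * t)) \<partial>K r) * indicator {0..<1} r)"
    using t by (auto simp: depth_density_def fun_eq_iff split: split_indicator)
  moreover have "(\<lambda>r. (\<integral>\<^sup>+v. ennreal (f v * exp (- v * t)) \<partial>K r) * indicator {0..<1} r) \<in> borel_measurable borel"
    using measurable_kernel_integral_indicator[of "\<lambda>v. ennreal (f v * exp (- v * t))" "{0..<1}"] by simp
  moreover have "(\<lambda>r. (\<integral>\<^sup>+v. ennreal (f v * (v * exp (- v * (t + r)))) \<partial>lam) * indicator {- t..<0} r) \<in> borel_measurable borel"
    by measurable
  ultimately show ?thesis by simp
qed

lemma kernel_prob:
  "AE y in lborel. y \<in> {0..<1} \<longrightarrow> distribution_on {0..} (K y)"
  using dis unfolding disintegrates_def by blast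

context
  fixes f :: "real \<Rightarrow> real"
  assumes f [measurable]: "f \<in> borel_measurable borel" and f_nonneg_all: "\<forall>v\<ge>0. 0 \<le> f v"
    and f_int: "integrable lam f"
begin

lemma f_nonneg: "0 \<le> v \<Longrightarrow> 0 \<le> f v"
  using f_nonneg_all by blast

lemma measurable_f_survival: "(\<lambda>p. f (fst p) * survival t r p) \<in> borel_measurable mu0"
  by (intro borel_measurable_times measurable_fst_mu0 f)
    (simp add: measurable_cong_sets[OF sets_initial_limit refl])

lemma nn_integral_depth_density_nonneg:
  assumes r: "0 \<le> r"
  shows "(\<integral>\<^sup>+s. depth_density f s * indicator {r..} s \<partial>lborel) = (\<integral>\<^sup>+p. ennreal (f (fst p) * survival t r p) \<partial>mu0)"
proof -
  have "(\<integral>\<^sup>+p. ennreal (f (fst p) * survival t r p) \<partial>mu0) =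
      (\<integral>\<^sup>+p. ennreal (f (fst p) * exp (- fst p * t)) * indicator {r..<1} (snd p) \<partial>mu0)"
    using AE_initial_limit r
    by (intro nn_integral_cong_AE) (auto simp: survival_def min_def split: split_indicator)
  also have "\<dots> = (\<integral>\<^sup>+y. (\<integral>\<^sup>+v. ennreal (f v * exp (- v * t)) \<partial>K y) * indicator {r..<1} y \<partial>lborel)"
    using r by (intro nn_integral_disintegrate) auto
  also have "\<dots> = (\<integral>\<^sup>+s. depth_density f s * indicator {r..} s \<partial>lborel)"
    using r t by (intro nn_integral_cong) (auto simp: depth_density_def split: split_indicator)
  finally show ?thesis by simp
qed

text \<open>
  Below depth 0, integrate out the time of the last jump: what accumulates between \<open>r\<close> and 0 is
  \<open>f(v) (e\<^bsup>-v(t+r)\<^esup> - e\<^bsup>-vt\<^esup>)\<close>, which completes the contribution \<open>f(v) e\<^bsup>-vt\<^esup>\<close> of the items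
  that have not jumped.
\<close>

lemma nn_integral_depth_density:
  assumes r: "- t \<le> r"
  shows "(\<integral>\<^sup>+s. depth_density f s * indicator {r..} s \<partial>lborel) = (\<integral>\<^sup>+p. ennreal (f (fst p) * survival t r p) \<partial>mu0)"
proof (cases "0 \<le> r")
  case True
  then show ?thesis by (rule nn_integral_depth_density_nonneg)
next
  case False
  interpret pair_sigma_finite lam lborel by standard
  let ?g = "\<lambda>v s. ennreal (f v * (v * exp (- v * (t + s))))"
  have split: "depth_density f s * indicator {r..} s =
      depth_density f s * indicator {0..} s + depth_density f s * indicator {r..<0} s" for s
    using False by (auto split: split_indicator)
  have "(\<integral>\<^sup>+s. depth_density f s * indicator {r..} s \<partial>lborel) =
      (\<integral>\<^sup>+s. depth_density f s * indicator {0..} s \<partial>lborel) + (\<integral>\<^sup>+s. depth_density f s * indicator {r..<0} s \<partial>lborel)"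
    unfolding split by (rule nn_integral_add) measurable
  also have "(\<integral>\<^sup>+s. depth_density f s * indicator {r..<0} s \<partial>lborel) =
      (\<integral>\<^sup>+s. (\<integral>\<^sup>+v. ?g v s * indicator {r..<0} s \<partial>lam) \<partial>lborel)"
    using r t by (intro nn_integral_cong) (auto simp: depth_density_def split: split_indicator)
  also have "\<dots> = (\<integral>\<^sup>+v. (\<integral>\<^sup>+s. ?g v s * indicator {r..<0} s \<partial>lborel) \<partial>lam)"
    by (rule Fubini') measurable
  also have "\<dots> = (\<integral>\<^sup>+v. ennreal (f v * (exp (- v * (t + r)) - exp (- v * t))) \<partial>lam)"
    using AE_rate_pos
    by (intro nn_integral_cong_AE, eventually_elim) (use False f_nonneg in \<open>intro nn_integral_exp_decay; simp\<close>)
  also have "(\<integral>\<^sup>+s. depth_density f s * indicator {0..} s \<partial>lborel) = (\<integral>\<^sup>+p. ennreal (f (fst p) * survival t 0 p) \<partial>mu0)"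
    by (rule nn_integral_depth_density_nonneg) simp
  also have "\<dots> = (\<integral>\<^sup>+p. ennreal (f (fst p) * exp (- fst p * t)) \<partial>mu0)"
    using AE_initial_limit by (intro nn_integral_cong_AE) (auto simp: survival_def)
  also have "\<dots> = (\<integral>\<^sup>+v. ennreal (f v * exp (- v * t)) \<partial>lam)"
    by (rule nn_integral_lam[symmetric]) measurable
  also have "(\<integral>\<^sup>+v. ennreal (f v * exp (- v * t)) \<partial>lam) +
      (\<integral>\<^sup>+v. ennreal (f v * (exp (- v * (t + r)) - exp (- v * t))) \<partial>lam) =
      (\<integral>\<^sup>+v. ennreal (f v * exp (- v * t)) + ennreal (f v * (exp (- v * (t + r)) - exp (- v * t))) \<partial>lam)"
    by (rule nn_integral_add[symmetric]) measurable
  also have "\<dots> = (\<integral>\<^sup>+v. ennreal (f v * exp (- v * (t + r))) \<partial>lam)"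
    using AE_rate_pos
  proof (intro nn_integral_cong_AE, eventually_elim)
    case (elim v)
    have "- v * t \<le> - v * (t + r)" using elim False by (intro mult_left_mono_neg) auto
    then have "0 \<le> exp (- v * (t + r)) - exp (- v * t)" by simp
    then have "0 \<le> f v * (exp (- v * (t + r)) - exp (- v * t))"
      using elim f_nonneg by (intro mult_nonneg_nonneg) (assumption | simp)+
    moreover have "0 \<le> f v * exp (- v * t)" using elim f_nonneg by simp
    ultimately show ?case by (simp only: ennreal_plus[symmetric] right_diff_distrib) simp
  qed
  also have "\<dots> = (\<integral>\<^sup>+p. ennreal (f (fst p) * exp (- fst p * (t + r))) \<partial>mu0)"
    by (rule nn_integral_lam) measurable
  also have "\<dots> = (\<integral>\<^sup>+p. ennreal (f (fst p) * survival t r p) \<partial>mu0)"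
    using AE_initial_limit False by (intro nn_integral_cong_AE) (auto simp: survival_def min_def)
  finally show ?thesis .
qed

lemma integrable_f_fst: "integrable mu0 (\<lambda>p. f (fst p))"
proof -
  have "integrable (distr mu0 borel fst) f" using f_int unfolding marginal .
  then show ?thesis by (subst (asm) integrable_distr_eq) auto
qed

lemma integrable_f_survival:
  assumes "- t \<le> r"
  shows "integrable mu0 (\<lambda>p. f (fst p) * survival t r p)"
proof (rule Bochner_Integration.integrable_bound[OF integrable_f_fst measurable_f_survival])
  show "AE p in mu0. norm (f (fst p) * survival t r p) \<le> norm (f (fst p))"
    using AE_initial_limit
  proof eventually_elim
    case (elim p)
    then have "survival t r p \<le> 1" using assms t by (auto simp: survival_def)
    then show ?case by (simp add: abs_mult mult_left_le)
  qed
qed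

lemma emeasure_depth_measure:
  assumes "- t \<le> r"
  shows "emeasure (depth_measure f) {r..} = ennreal (LINT p|mu0. f (fst p) * survival t r p)"
proof -
  have "emeasure (depth_measure f) {r..} = (\<integral>\<^sup>+s. depth_density f s * indicator {r..} s \<partial>lborel)"
    unfolding depth_measure_def by (rule emeasure_density) auto
  also have "\<dots> = (\<integral>\<^sup>+p. ennreal (f (fst p) * survival t r p) \<partial>mu0)"
    by (rule nn_integral_depth_density[OF assms])
  also have "\<dots> = ennreal (LINT p|mu0. f (fst p) * survival t r p)"
    using AE_initial_limit by (intro nn_integral_eq_integral integrable_f_survival assms)
      (auto elim!: eventually_mono intro!: f_nonneg mult_nonneg_nonneg)
  finally show ?thesis .
qed

lemma depth_tail_eq: "- t \<le> r \<Longrightarrow> depth_tail f r = (LINT p|mu0. f (fst p) * survival t r p)"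
  unfolding depth_tail_def measure_def using emeasure_depth_measure
  using AE_initial_limit by (simp, intro enn2real_ennreal integral_nonneg_AE)
     (auto elim!: eventually_mono intro!: f_nonneg mult_nonneg_nonneg)

lemma emeasure_depth_measure_below: "emeasure (depth_measure f) {..<- t} = 0"
proof -
  have "emeasure (depth_measure f) {..<- t} = (\<integral>\<^sup>+s. depth_density f s * indicator {..<- t} s \<partial>lborel)"
    unfolding depth_measure_def by (rule emeasure_density) auto
  also have "\<dots> = (\<integral>\<^sup>+(s::real). 0 \<partial>lborel)"
    by (intro nn_integral_cong) (auto simp: depth_density_def split: split_indicator)
  finally show ?thesis by simp
qed

lemma finite_borel_depth_measure: "finite_borel_measure (depth_measure f)"
proof (intro finite_borel_measure.intro finite_measureI finite_borel_measure_axioms.intro)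
  have "emeasure (depth_measure f) UNIV = emeasure (depth_measure f) ({..<- t} \<union> {- t..})"
    by (rule arg_cong[where f="emeasure _"]) auto
  also have "\<dots> \<le> emeasure (depth_measure f) {..<- t} + emeasure (depth_measure f) {- t..}"
    by (rule emeasure_subadditive) (auto simp: depth_measure_def)
  also have "\<dots> < \<infinity>" by (simp add: emeasure_depth_measure_below emeasure_depth_measure)
  finally show "emeasure (depth_measure f) (space (depth_measure f)) \<noteq> \<infinity>" by (simp add: depth_measure_def)
qed (simp add: depth_measure_def)

lemma depth_measure_no_atom: "emeasure (depth_measure f) {r} = 0"
proof -
  have "emeasure (depth_measure f) {r} = (\<integral>\<^sup>+s. depth_density f s * indicator {r} s \<partial>lborel)"
    unfolding depth_measure_def by (rule emeasure_density) auto
  also have "\<dots> = (\<integral>\<^sup>+(s::real). 0 \<partial>lborel)"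
    by (rule nn_integral_cong_AE, rule eventually_mono[OF AE_lborel_singleton[of r]]) simp
  finally show ?thesis by simp
qed

lemma depth_tail_eq_cdf: "depth_tail f r = measure (depth_measure f) UNIV - cdf (depth_measure f) r"
proof -
  interpret finite_borel_measure "depth_measure f" by (rule finite_borel_depth_measure)
  have "measure (depth_measure f) {r..} = measure (depth_measure f) {r<..}"
    by (rule finite_measure_eq_AE)
      (auto intro!: AE_I[of _ _ "{r}"] simp: depth_measure_no_atom)
  also have "{r<..} = space (depth_measure f) - {..r}" by (auto simp: depth_measure_def)
  also have "measure (depth_measure f) \<dots> = measure (depth_measure f) UNIV - cdf (depth_measure f) r"
    unfolding cdf_def by (subst finite_measure_compl) (auto simp: depth_measure_def)
  finally show ?thesis unfolding depth_tail_def .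
qed

lemma isCont_depth_tail: "isCont (depth_tail f) r"
proof -
  interpret finite_borel_measure "depth_measure f" by (rule finite_borel_depth_measure)
  have "isCont (cdf (depth_measure f)) r"
    unfolding isCont_cdf by (simp add: measure_def depth_measure_no_atom)
  then have "isCont (\<lambda>r. measure (depth_measure f) UNIV - cdf (depth_measure f) r) r"
    by (intro continuous_intros)
  then show ?thesis by (simp add: depth_tail_eq_cdf[abs_def])
qed

lemma depth_density_finite: "AE r in lborel. depth_density f r \<noteq> \<infinity>"
proof (rule nn_integral_PInf_AE)
  have "(\<integral>\<^sup>+s. depth_density f s \<partial>lborel) = emeasure (depth_measure f) UNIV"
    unfolding depth_measure_def by (subst emeasure_density) auto
  also have "\<dots> \<noteq> \<infinity>"
    using finite_borel_depth_measure
    by (metis finite_borel_measure.axioms(1) finite_measure.emeasure_finite infinity_ennreal_def)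
  finally show "(\<integral>\<^sup>+s. depth_density f s \<partial>lborel) \<noteq> \<infinity>" .
qed measurable

end


lemma constant_weight: "(\<lambda>_. 1 :: real) \<in> borel_measurable borel" "\<forall>v\<ge>0::real. 0 \<le> (1::real)"
    "integrable lam (\<lambda>_. 1 :: real)"
  by auto

lemma rate_weight: "(\<lambda>v::real. v) \<in> borel_measurable borel" "\<forall>v\<ge>0::real. 0 \<le> v"
    "integrable lam (\<lambda>v. v)"
  by (simp, simp, rule lam(3))

lemmas depth_tail_one_eq = depth_tail_eq[where f = "\<lambda>_. 1", OF constant_weight]
lemmas finite_borel_one = finite_borel_depth_measure[where f = "\<lambda>_. 1", OF constant_weight]

text \<open>
  The limit of the fraction of items of depth below \<open>r\<close>.
\<close>

definition position :: "real \<Rightarrow> real" where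
  "position r = 1 - depth_tail (\<lambda>_. 1) r"

lemma depth_tail_antimono: "r \<le> s \<Longrightarrow> depth_tail (\<lambda>_. 1) s \<le> depth_tail (\<lambda>_. 1) r"
proof -
  assume "r \<le> s"
  interpret finite_borel_measure "depth_measure (\<lambda>_. 1)" by (rule finite_borel_one)
  show ?thesis unfolding depth_tail_def
    using \<open>r \<le> s\<close> by (intro finite_measure_mono) auto
qed

lemma position_mono: "r \<le> s \<Longrightarrow> position r \<le> position s"
  unfolding position_def using depth_tail_antimono by simp

lemma position_at_minus_t: "position (- t) = 0"
proof -
  have "depth_tail (\<lambda>_. 1) (- t) = (LINT p|mu0. 1)"
    unfolding depth_tail_one_eq[OF order_refl]
    using AE_initial_limit t by (intro integral_cong_AE) (auto simp: survival_def measurable_cong_sets[OF sets_initial_limit refl])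
  then show ?thesis by (simp add: position_def mu0.prob_space)
qed

lemma depth_tail_right: "depth_tail (\<lambda>_. 1) 1 = 0"
proof -
  have "depth_tail (\<lambda>_. 1) 1 = (LINT p|mu0. 0)"
    using t AE_initial_limit
    by (subst depth_tail_one_eq, simp, intro integral_cong_AE)
      (auto simp: survival_def measurable_cong_sets[OF sets_initial_limit refl])
  then show ?thesis by simp
qed

lemma position_ge_one: "1 \<le> r \<Longrightarrow> position r = 1"
  using depth_tail_antimono[of 1 r] depth_tail_right
  by (simp add: position_def depth_tail_def measure_le_0_iff)

lemma position_le_left: "r \<le> - t \<Longrightarrow> position r \<le> 0"
  using position_mono[of r "- t"] position_at_minus_t by simp

text \<open>
  At negative depth this rests on \<open>\<lambda>({0}) = 0\<close>, as items of rate 0 never reach the front; at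
  nonnegative depth, on the kernels being probability measures.
\<close>

lemma depth_density_one_pos: "AE r in lborel. r \<in> {- t..<1} \<longrightarrow> 0 < depth_density (\<lambda>_. 1) r"
  using kernel_prob
proof eventually_elim
  case (elim r)
  show ?case
  proof (intro impI)
    assume r: "r \<in> {- t..<1}"
    show "0 < depth_density (\<lambda>_. 1) r"
    proof (cases "r < 0")
      case True
      have "(\<integral>\<^sup>+v. ennreal (1 * (v * exp (- v * (t + r)))) \<partial>lam) \<noteq> 0"
      proof
        assume "(\<integral>\<^sup>+v. ennreal (1 * (v * exp (- v * (t + r)))) \<partial>lam) = 0"
        then have "AE v in lam. ennreal (1 * (v * exp (- v * (t + r)))) = 0"
          by (subst (asm) nn_integral_0_iff_AE) auto
        then have "AE v in lam. False" using AE_rate_pos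
          by eventually_elim (simp add: mult_le_0_iff ennreal_eq_0_iff)
        then show False by simp
      qed
      then show ?thesis using True r by (simp add: depth_density_def zero_less_iff_neq_zero)
    next
      case False
      then have P: "distribution_on {0..} (K r)" using elim r by auto
      then interpret Kr: prob_space "K r" by (simp add: distribution_on_def)
      have sK: "sets (K r) = sets borel" using P by (simp add: distribution_on_def)
      have "(\<integral>\<^sup>+v. ennreal (1 * exp (- v * t)) \<partial>K r) \<noteq> 0"
      proof
        assume "(\<integral>\<^sup>+v. ennreal (1 * exp (- v * t)) \<partial>K r) = 0"
        then have "AE v in K r. ennreal (1 * exp (- v * t)) = 0"
          by (subst (asm) nn_integral_0_iff_AE) (auto simp: measurable_cong_sets[OF sK refl])
        then have "AE v in K r. False" by eventually_elim simp
        then show False by simp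
      qed
      then show ?thesis using False r by (simp add: depth_density_def zero_less_iff_neq_zero)
    qed
  qed
qed

lemma position_strict_mono:
  assumes "- t \<le> a" "a < b" "b \<le> 1"
  shows "position a < position b"
proof -
  interpret D: finite_borel_measure "depth_measure (\<lambda>_. 1)" by (rule finite_borel_one)
  have "{a..} = {a..<b} \<union> {b..}" using assms by auto
  then have "depth_tail (\<lambda>_. 1) a = measure (depth_measure (\<lambda>_. 1)) {a..<b} + depth_tail (\<lambda>_. 1) b"
    unfolding depth_tail_def by (subst D.finite_measure_Union[symmetric]) auto
  moreover have "measure (depth_measure (\<lambda>_. 1)) {a..<b} \<noteq> 0"
  proof
    assume "measure (depth_measure (\<lambda>_. 1)) {a..<b} = 0"
    then have "emeasure (depth_measure (\<lambda>_. 1)) {a..<b} = 0" by (simp add: D.emeasure_eq_measure)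
    moreover have "emeasure (depth_measure (\<lambda>_. 1)) {a..<b} =
        (\<integral>\<^sup>+s. depth_density (\<lambda>_. 1) s * indicator {a..<b} s \<partial>lborel)"
      unfolding depth_measure_def by (rule emeasure_density) auto
    ultimately have "AE s in lborel. depth_density (\<lambda>_. 1) s * indicator {a..<b} s = 0"
      by (simp add: nn_integral_0_iff_AE)
    then have "AE s in lborel. s \<notin> {a..<b}"
      using depth_density_one_pos
    proof eventually_elim
      case (elim s)
      then show ?case using assms by (auto split: split_indicator_asm)
    qed
    then have "{a..<b} \<in> null_sets lborel" by (subst (asm) AE_iff_null_sets[symmetric]) auto
    then show False using assms by (simp add: null_sets_def)
  qed
  ultimately show ?thesis
    unfolding position_def using measure_nonneg[of "depth_measure (\<lambda>_. 1)" "{a..<b}"] by linarith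
qed

definition depth_at :: "real \<Rightarrow> real" where
  "depth_at = the_inv_into {- t..1} position"

lemma inj_on_position: "inj_on position {- t..1}"
  by (intro linorder_inj_onI) (use position_strict_mono in force)+

lemma depth_at:
  assumes "0 \<le> y" "y \<le> 1"
  shows "- t \<le> depth_at y" "depth_at y \<le> 1" "position (depth_at y) = y"
proof -
  have "\<exists>r. - t \<le> r \<and> r \<le> 1 \<and> position r = y"
  proof (rule IVT)
    show "\<forall>r. - t \<le> r \<and> r \<le> 1 \<longrightarrow> isCont position r"
      unfolding position_def[abs_def] using isCont_depth_tail[where f = "\<lambda>_. 1", OF constant_weight]
      by (auto intro!: continuous_intros)
  qed (use assms position_at_minus_t position_ge_one[of 1] t in auto)
  then have y: "y \<in> position ` {- t..1}" by auto
  show "position (depth_at y) = y" unfolding depth_at_def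
    by (rule f_the_inv_into_f[OF inj_on_position y])
  have "depth_at y \<in> {- t..1}" unfolding depth_at_def
    by (rule the_inv_into_into[OF inj_on_position y order_refl])
  then show "- t \<le> depth_at y" "depth_at y \<le> 1" by auto
qed

lemma depth_at_less_one: "0 \<le> y \<Longrightarrow> y < 1 \<Longrightarrow> depth_at y < 1"
  using depth_at[of y] position_ge_one[of 1] by (cases "depth_at y = 1") auto

lemma depth_at_le_iff:
  assumes "0 < y" "y < 1"
  shows "depth_at y \<le> c \<longleftrightarrow> y \<le> position c"
proof
  assume "depth_at y \<le> c"
  then show "y \<le> position c" using position_mono[of "depth_at y" c] depth_at[of y] assms by simp
next
  assume y: "y \<le> position c"
  show "depth_at y \<le> c"
  proof (rule ccontr)
    assume "\<not> depth_at y \<le> c"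
    then show False
      using y assms depth_at[of y] position_strict_mono[of c "depth_at y"] position_le_left[of c]
      by (cases "- t \<le> c") auto
  qed
qed

text \<open>
  \<open>position\<close> is the distribution function of \<open>depth_measure (\<lambda>_. 1)\<close>, and \<open>depth_at\<close> is its inverse;
  this is the quantile transform.  It replaces the substitution \<open>y = position r\<close>, for which
  \<open>position\<close> is in general not smooth enough: it has a derivative only almost everywhere.
\<close>

lemma depth_at_quantile:
  "depth_at \<in> borel_measurable (restrict_space lborel {0<..<1})"
  "distr (restrict_space lborel {0<..<1}) borel depth_at = depth_measure (\<lambda>_. 1)"
proof -
  let ?U = "restrict_space lborel {0<..<1::real}"
  interpret D: finite_borel_measure "depth_measure (\<lambda>_. 1)" by (rule finite_borel_one)
  interpret U: prob_space ?U
    by (auto simp: space_restrict_space emeasure_restrict_space intro!: prob_spaceI)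
  have set: "{y \<in> space ?U. depth_at y \<le> c} = {0<..<1} \<inter> {..position c}" for c
    using depth_at_le_iff by (auto simp: space_restrict_space)
  show m: "depth_at \<in> borel_measurable ?U"
    unfolding borel_measurable_iff_le set by (auto simp: sets_restrict_space)
  show "distr ?U borel depth_at = depth_measure (\<lambda>_. 1)"
  proof (rule cdf_unique')
    show "finite_borel_measure (distr ?U borel depth_at)"
      using U.prob_space_distr[OF m]
      by (intro finite_borel_measure.intro finite_borel_measure_axioms.intro)
        (auto simp: prob_space_def)
    show "finite_borel_measure (depth_measure (\<lambda>_. 1))" by (rule finite_borel_one)
    have total: "measure (depth_measure (\<lambda>_. 1)) UNIV = 1"
    proof -
      have "measure (depth_measure (\<lambda>_. 1)) UNIV = measure (depth_measure (\<lambda>_. 1)) {- t..}"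
        by (rule D.finite_measure_eq_AE, rule AE_I[of _ _ "{..<- t}"])
          (auto simp: emeasure_depth_measure_below[where f = "\<lambda>_. 1", OF constant_weight])
      then show ?thesis using position_at_minus_t by (simp add: position_def depth_tail_def)
    qed
    show "cdf (distr ?U borel depth_at) = cdf (depth_measure (\<lambda>_. 1))"
    proof
      fix c
      have pos: "cdf (depth_measure (\<lambda>_. 1)) c = position c"
        using depth_tail_eq_cdf[where f = "\<lambda>_. 1", OF constant_weight, of c] total by (simp add: position_def)
      have p01: "0 \<le> position c" "position c \<le> 1"
        using D.finite_measure_mono[of "{..c}" UNIV] total
        by (simp_all add: pos[symmetric] cdf_def depth_measure_def)
      have "cdf (distr ?U borel depth_at) c = measure ?U {y \<in> space ?U. depth_at y \<le> c}"
        unfolding cdf_def by (subst measure_distr[OF m]) (auto intro!: arg_cong[where f="measure _"])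
      also have "\<dots> = measure lborel ({0<..<1} \<inter> {..position c})"
        unfolding set by (rule measure_restrict_space) auto
      also have "\<dots> = position c"
      proof (cases "position c < 1")
        case True
        then have "{0<..<1} \<inter> {..position c} = {0<..position c}" by auto
        then show ?thesis using p01 by simp
      next
        case False
        then have "position c = 1" using p01 by simp
        moreover from this have "{0<..<1} \<inter> {..position c} = {0<..<1}" by auto
        ultimately show ?thesis by simp
      qed
      finally show "cdf (distr ?U borel depth_at) c = cdf (depth_measure (\<lambda>_. 1)) c" using pos by simp
    qed
  qed
qed

end

section \<open>The mean of the limit distribution\<close>

context ranking_limit
begin

lemma integrable_exp_lam: "0 \<le> u \<Longrightarrow> integrable lam (\<lambda>v. exp (- v * u))"
proof (rule Bochner_Integration.integrable_bound[of lam "\<lambda>_. 1 :: real"])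
  assume u: "0 \<le> u"
  show "AE v in lam. norm (exp (- v * u)) \<le> norm (1 :: real)"
    using AE_rate_pos by eventually_elim (use u in simp)
qed auto

lemma y_C_strict_mono:
  assumes "0 \<le> a" "a < b"
  shows "y_C lam a < y_C lam b"
proof -
  have "(LINT v|lam. exp (- v * b)) < (LINT v|lam. exp (- v * a))"
  proof (rule lam.integral_less_AE_space)
    show "AE v in lam. exp (- v * b) < exp (- v * a)"
      using AE_rate_pos by eventually_elim (use assms in simp)
  qed (use assms lam.emeasure_space_1 integrable_exp_lam[of a] integrable_exp_lam[of b] in auto)
  then show ?thesis by (simp add: y_C_def)
qed

lemma position_eq_y_C:
  assumes "- t \<le> r" "r \<le> 0"
  shows "position r = y_C lam (t + r)"
proof -
  have "depth_tail (\<lambda>_. 1) r = (LINT p|mu0. exp (- fst p * (t + r)))"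
    unfolding depth_tail_one_eq[OF assms(1)]
  proof (rule integral_cong_AE)
    show "AE p in mu0. 1 * survival t r p = exp (- fst p * (t + r))"
      using AE_initial_limit by eventually_elim (use assms in \<open>simp add: survival_def\<close>)
  qed (simp_all add: measurable_cong_sets[OF sets_initial_limit refl])
  also have "\<dots> = (LINT v|distr mu0 borel fst. exp (- v * (t + r)))"
    by (rule integral_distr[symmetric]) simp_all
  finally show ?thesis unfolding marginal by (simp add: position_def y_C_def)
qed

lemma position_zero: "position 0 = y_C lam t"
  using position_eq_y_C[of 0] t by simp

lemma t_0_eq:
  assumes y: "0 \<le> y" "y < y_C lam t"
  shows "t_0 lam y = t + depth_at y" "depth_at y < 0"
proof -
  have y1: "y \<le> 1" using y position_mono[of 0 1] position_ge_one[of 1] by (simp add: position_zero)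
  note d = depth_at[OF y(1) y1]
  show neg: "depth_at y < 0"
    using d(3) y position_mono[of 0 "depth_at y"] by (cases "depth_at y < 0") (auto simp: position_zero)
  show "t_0 lam y = t + depth_at y"
    unfolding t_0_def
  proof (rule the_inv_into_f_eq)
    show "inj_on (y_C lam) {0..}"
      by (intro linorder_inj_onI) (use y_C_strict_mono in force)+
    show "y_C lam (t + depth_at y) = y" using position_eq_y_C[of "depth_at y"] neg d by simp
  qed (use d in simp)
qed

lemma kernel_integral_eq:
  assumes "r \<in> {0..<1}"
  shows "(LINT v|K r. exp (- v * t)) = enn2real (depth_density (\<lambda>_. 1) r)"
proof -
  have "(LINT v|K r. exp (- v * t)) = enn2real (\<integral>\<^sup>+v. ennreal (exp (- v * t)) \<partial>K r)"
    by (rule integral_eq_nn_integral) (simp_all add: measurable_cong_sets[OF sets_kernel[OF assms] refl])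
  then show ?thesis using assms t by (simp add: depth_density_def)
qed

lemma y_flow_eq:
  assumes "0 \<le> r" "r < 1"
  shows "y_flow K r t = position r"
proof -
  have "(LINT z:{r..<1}|lborel. LINT v|K z. exp (- v * t)) =
      (LINT z|lborel. indicator {r..} z * enn2real (depth_density (\<lambda>_. 1) z))"
    unfolding set_lebesgue_integral_def
  proof (rule Bochner_Integration.integral_cong)
    fix z
    show "indicator {r..<1} z *\<^sub>R (LINT v|K z. exp (- v * t)) =
        indicator {r..} z * enn2real (depth_density (\<lambda>_. 1) z)"
      using assms kernel_integral_eq[of z]
      by (auto simp: depth_density_def split: split_indicator)
  qed simp
  also have "\<dots> = enn2real (\<integral>\<^sup>+z. ennreal (indicator {r..} z * enn2real (depth_density (\<lambda>_. 1) z)) \<partial>lborel)"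
    by (rule integral_eq_nn_integral) auto
  also have "(\<integral>\<^sup>+z. ennreal (indicator {r..} z * enn2real (depth_density (\<lambda>_. 1) z)) \<partial>lborel) =
      (\<integral>\<^sup>+z. depth_density (\<lambda>_. 1) z * indicator {r..} z \<partial>lborel)"
    using depth_density_finite[where f = "\<lambda>_. 1", OF constant_weight]
    by (intro nn_integral_cong_AE, eventually_elim)
      (auto simp: ennreal_mult less_top[symmetric] ennreal_enn2real_if split: split_indicator)
  also have "\<dots> = emeasure (depth_measure (\<lambda>_. 1)) {r..}"
    unfolding depth_measure_def by (rule emeasure_density[symmetric]) auto
  finally show ?thesis by (simp add: y_flow_def position_def depth_tail_def measure_def)
qed

lemma y_hat_eq:
  assumes y: "y_C lam t \<le> y" "y < 1"
  shows "y_hat K y t = depth_at y" "0 \<le> depth_at y" "depth_at y < 1"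
proof -
  have y0: "0 \<le> y"
    using y position_mono[of "- t" 0] t position_at_minus_t by (simp add: position_zero)
  note d = depth_at[of y]
  show neg: "0 \<le> depth_at y"
    using d y0 y position_strict_mono[of "depth_at y" 0]
    by (cases "0 \<le> depth_at y") (auto simp: position_zero)
  show lt: "depth_at y < 1" by (rule depth_at_less_one[OF y0 y(2)])
  show "y_hat K y t = depth_at y"
    unfolding y_hat_def
  proof (rule the_inv_into_f_eq)
    show "inj_on (\<lambda>z. y_flow K z t) {0..<1}"
    proof (rule linorder_inj_onI)
      fix a b :: real assume "a < b" "a \<in> {0..<1}" "b \<in> {0..<1}"
      then show "y_flow K a t \<noteq> y_flow K b t"
        using position_strict_mono[of a b] t by (simp add: y_flow_eq)
    qed auto
    show "y_flow K (depth_at y) t = y" using y_flow_eq[OF neg lt] d y0 y by simp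
  qed (use neg lt in simp)
qed

text \<open>
  The Bochner integral is 0 where the integrand is not integrable, and the kernels in an
  exceptional null set may charge negative rates; the statement covers these values as well.
  They matter because the integral over \<open>y\<close> in the main result requires a Borel measurable integrand.
\<close>

lemma measurable_kernel_LINT:
  fixes f :: "real \<Rightarrow> real"
  assumes f [measurable]: "f \<in> borel_measurable borel"
  shows "(\<lambda>r. (LINT v|K r. f v) * indicator {0..<1} r) \<in> borel_measurable borel"
proof -
  define P where "P r = (\<integral>\<^sup>+v. ennreal (f v) \<partial>K r) * indicator {0..<1} r" for r
  define Q where "Q r = (\<integral>\<^sup>+v. ennreal (- f v) \<partial>K r) * indicator {0..<1} r" for r
  have [measurable]: "P \<in> borel_measurable borel" "Q \<in> borel_measurable borel"
    unfolding P_def[abs_def] Q_def[abs_def]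
    using measurable_kernel_integral_indicator[of "\<lambda>v. ennreal (f v)" "{0..<1}"]
      measurable_kernel_integral_indicator[of "\<lambda>v. ennreal (- f v)" "{0..<1}"] by simp_all
  have "(LINT v|K r. f v) * indicator {0..<1} r =
      (if P r \<noteq> \<infinity> \<and> Q r \<noteq> \<infinity> then enn2real (P r) - enn2real (Q r) else 0)" for r
  proof (cases "r \<in> {0..<1}")
    case True
    have "f \<in> borel_measurable (K r)" using f measurable_cong_sets[OF sets_kernel[OF True] refl] by blast
    then have "integrable (K r) f \<longleftrightarrow> P r \<noteq> \<infinity> \<and> Q r \<noteq> \<infinity>"
      unfolding real_integrable_def P_def Q_def using True by simp
    then show ?thesis
      using True real_lebesgue_integral_def[of "K r" f] not_integrable_integral_eq[of "K r" f]
      by (auto simp: P_def Q_def)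
  qed (simp add: P_def Q_def)
  then show ?thesis by simp
qed

text \<open>
  The mean of \<open>\<mu>\<^bsub>y,t\<^esub>\<close>, as a function of the depth \<open>r\<close> instead of the position \<open>y\<close>.  It is a quotient
  of Bochner integrals, which makes the identification with the mean hold for every \<open>y\<close> and not only
  almost everywhere.
\<close>

definition mean_rate :: "real \<Rightarrow> real" where
  "mean_rate r =
     (if r < 0 then (LINT v|lam. v * (v * exp (- v * (t + r)))) / (LINT v|lam. v * exp (- v * (t + r)))
      else (LINT v|K r. v * exp (- v * t)) / (LINT v|K r. exp (- v * t))) * indicator {..<1} r"

lemma measurable_mean_rate [measurable]: "mean_rate \<in> borel_measurable borel"
proof -
  have eq: "mean_rate = (\<lambda>r.
      if r < 0 then (LINT v|lam. v * (v * exp (- v * (t + r)))) / (LINT v|lam. v * exp (- v * (t + r)))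
      else ((LINT v|K r. v * exp (- v * t)) * indicator {0..<1} r) / ((LINT v|K r. exp (- v * t)) * indicator {0..<1} r))"
    by (auto simp: mean_rate_def fun_eq_iff split: split_indicator)
  have K: "(\<lambda>r. (LINT v|K r. v * exp (- v * t)) * indicator {0..<1} r) \<in> borel_measurable borel"
    "(\<lambda>r. (LINT v|K r. exp (- v * t)) * indicator {0..<1} r) \<in> borel_measurable borel"
    using measurable_kernel_LINT[of "\<lambda>v. v * exp (- v * t)"] measurable_kernel_LINT[of "\<lambda>v. exp (- v * t)"]
    by simp_all
  have L: "(\<lambda>r. LINT v|lam. v * (v * exp (- v * (t + r)))) \<in> borel_measurable borel"
    "(\<lambda>r. LINT v|lam. v * exp (- v * (t + r))) \<in> borel_measurable borel"
    by measurable
  show ?thesis unfolding eq by (intro measurable_If borel_measurable_divide K L) simp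
qed

lemma LINT_density_ratio:
  assumes sets: "sets P = sets borel" and g: "g \<in> borel_measurable borel" "AE v in P. 0 \<le> g v"
  shows "(LINT v|density P (\<lambda>v. ennreal (g v / (LINT u|P. g u))). v) = (LINT v|P. v * g v) / (LINT v|P. g v)"
proof -
  note [measurable_cong] = sets
  note [measurable] = g(1)
  let ?c = "LINT u|P. g u"
  have c: "0 \<le> ?c" by (rule integral_nonneg_AE[OF g(2)])
  have "(LINT v|density P (\<lambda>v. ennreal (g v / ?c)). v) = (LINT v|P. (g v / ?c) *\<^sub>R v)"
  proof (rule integral_density)
    show "AE v in P. 0 \<le> g v / ?c" using g(2) by eventually_elim (use c in simp)
  qed measurable
  also have "\<dots> = (LINT v|P. v * g v / ?c)"
    by (intro Bochner_Integration.integral_cong) (auto simp: field_simps)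
  also have "\<dots> = (LINT v|P. v * g v) / ?c" by (rule Bochner_Integration.integral_divide_zero)
  finally show ?thesis .
qed

lemma mean_limit_distribution:
  assumes y: "0 < y" "y < 1"
  shows "(LINT v|limit_distribution lam K y t. v) = mean_rate (depth_at y)"
proof (cases "y < y_C lam t")
  case True
  have d: "t_0 lam y = t + depth_at y" "depth_at y < 0" using t_0_eq[OF _ True] y by auto
  have "AE v in lam. 0 \<le> v * exp (- v * (t + depth_at y))" using AE_rate_pos by eventually_elim simp
  then show ?thesis
    using LINT_density_ratio[of lam "\<lambda>v. v * exp (- v * (t + depth_at y))"] True d
    by (simp add: limit_distribution_def mean_rate_def)
next
  case False
  have d: "y_hat K y t = depth_at y" "0 \<le> depth_at y" "depth_at y < 1"
    using y_hat_eq[of y] False y by auto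
  then show ?thesis
    using LINT_density_ratio[of "K (depth_at y)" "\<lambda>v. exp (- v * t)"] False sets_kernel[of "depth_at y"]
    by (simp add: limit_distribution_def mean_rate_def)
qed

lemma mean_rate_eq: "AE r in lborel. r \<in> {- t..<1} \<longrightarrow>
  mean_rate r = enn2real (depth_density (\<lambda>v. v) r) / enn2real (depth_density (\<lambda>_. 1) r)"
  using kernel_prob
proof eventually_elim
  case (elim r)
  show ?case
  proof
    assume r: "r \<in> {- t..<1}"
    show "mean_rate r = enn2real (depth_density (\<lambda>v. v) r) / enn2real (depth_density (\<lambda>_. 1) r)"
    proof (cases "r < 0")
      case True
      have nn: "AE v in lam. 0 \<le> v * (v * exp (- v * (t + r)))" "AE v in lam. 0 \<le> v * exp (- v * (t + r))"
        using AE_rate_pos by (eventually_elim, simp)+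
      show ?thesis
        using True r integral_eq_nn_integral[OF _ nn(1)] integral_eq_nn_integral[OF _ nn(2)]
        by (simp add: mean_rate_def depth_density_def)
    next
      case False
      then have P: "distribution_on {0..} (K r)" using elim r by auto
      then have "AE v in K r. v \<in> {0..}" by (simp add: distribution_on_def)
      then have nn: "AE v in K r. 0 \<le> v * exp (- v * t)" by eventually_elim simp
      have "sets (K r) = sets borel" using P by (simp add: distribution_on_def)
      then have "(\<lambda>v. v * exp (- v * t)) \<in> borel_measurable (K r)" by (simp cong: measurable_cong_sets)
      then show ?thesis
        using False r integral_eq_nn_integral[OF _ nn] kernel_integral_eq[of r]
        by (simp add: mean_rate_def depth_density_def)
    qed
  qed
qed

text \<open>
  The denominator of the mean rate is the density of the law of the depth and cancels.
\<close>

lemma nn_integral_mean_rate: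
  "(\<integral>\<^sup>+s. ennreal (indicator {r<..} s * mean_rate s) \<partial>depth_measure (\<lambda>_. 1)) = emeasure (depth_measure (\<lambda>v. v)) {r<..}"
proof -
  have [measurable]: "depth_density (\<lambda>v. v) \<in> borel_measurable borel"
    by (rule measurable_depth_density[OF rate_weight(1)])
  have "(\<integral>\<^sup>+s. ennreal (indicator {r<..} s * mean_rate s) \<partial>depth_measure (\<lambda>_. 1)) =
      (\<integral>\<^sup>+s. depth_density (\<lambda>_. 1) s * ennreal (indicator {r<..} s * mean_rate s) \<partial>lborel)"
    unfolding depth_measure_def by (rule nn_integral_density) measurable
  also have "\<dots> = (\<integral>\<^sup>+s. depth_density (\<lambda>v. v) s * indicator {r<..} s \<partial>lborel)"
    using mean_rate_eq depth_density_one_pos depth_density_finite[where f = "\<lambda>_. 1", OF constant_weight]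
      depth_density_finite[where f = "\<lambda>v. v", OF rate_weight]
  proof (intro nn_integral_cong_AE, eventually_elim)
    case (elim s)
    show ?case
    proof (cases "s \<in> {- t..<1} \<and> r < s")
      case True
      obtain a where a: "0 < a" "depth_density (\<lambda>_. 1) s = ennreal a"
        using elim True by (cases "depth_density (\<lambda>_. 1) s") auto
      obtain b where b: "0 \<le> b" "depth_density (\<lambda>v. v) s = ennreal b"
        using elim by (cases "depth_density (\<lambda>v. v) s") auto
      have "mean_rate s = b / a" using elim True a b by simp
      then show ?thesis using a b True by (simp add: ennreal_mult[symmetric])
    next
      case False
      then show ?thesis by (auto simp: depth_density_def split: split_indicator)
    qed
  qed
  also have "\<dots> = emeasure (depth_measure (\<lambda>v. v)) {r<..}"
    unfolding depth_measure_def by (rule emeasure_density[symmetric]) measurable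
  finally show ?thesis .
qed

text \<open>
  Transport the integral over positions to depths by the quantile transform; the interval \<open>(x,1)\<close>
  becomes the set of depths beyond \<open>depth_at x\<close>.
\<close>

theorem integral_limit_distribution:
  assumes x: "0 \<le> x" "x < 1"
  shows "(LINT y:{x<..<1}|lborel. LINT v|limit_distribution lam K y t. v) = depth_tail (\<lambda>v. v) (depth_at x)"
proof -
  let ?U = "restrict_space lborel {0<..<1::real}"
  let ?d = "depth_at x"
  let ?h = "\<lambda>r. indicator {?d<..} r * mean_rate r"
  interpret D: finite_borel_measure "depth_measure (\<lambda>v. v)" by (rule finite_borel_depth_measure[OF rate_weight])
  have gt: "x < y \<longleftrightarrow> ?d < depth_at y" if "0 < y" "y < 1" for y
    using depth_at_le_iff[OF that, of ?d] depth_at[of x] x by (auto simp: not_le[symmetric])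
  have h: "?h \<in> borel_measurable borel" by measurable
  have "(LINT y:{x<..<1}|lborel. LINT v|limit_distribution lam K y t. v) =
      (LINT y|lborel. indicator {0<..<1} y *\<^sub>R ?h (depth_at y))"
    unfolding set_lebesgue_integral_def
  proof (rule Bochner_Integration.integral_cong[OF refl])
    fix y
    show "indicator {x<..<1} y *\<^sub>R (LINT v|limit_distribution lam K y t. v) =
        indicator {0<..<1} y *\<^sub>R ?h (depth_at y)"
    proof (cases "y \<in> {0<..<1}")
      case True
      then show ?thesis using gt[of y] mean_limit_distribution[of y] by (auto split: split_indicator)
    qed (use x in \<open>auto split: split_indicator\<close>)
  qed
  also have "\<dots> = (LINT y|?U. ?h (depth_at y))" by (rule integral_restrict_space[symmetric]) simp
  also have "\<dots> = (LINT r|depth_measure (\<lambda>_. 1). ?h r)"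
    unfolding depth_at_quantile(2)[symmetric] by (rule integral_distr[OF depth_at_quantile(1) h, symmetric])
  also have "\<dots> = enn2real (\<integral>\<^sup>+r. ennreal (?h r) \<partial>depth_measure (\<lambda>_. 1))"
  proof (rule integral_eq_nn_integral)
    show "?h \<in> borel_measurable (depth_measure (\<lambda>_. 1))" using h by (simp add: depth_measure_def)
    have "AE r in lborel. 0 < depth_density (\<lambda>_. 1) r \<longrightarrow> 0 \<le> ?h r"
      using mean_rate_eq
      by eventually_elim (auto simp: depth_density_def split: split_indicator split_indicator_asm)
    then show "AE r in depth_measure (\<lambda>_. 1). 0 \<le> ?h r"
      unfolding depth_measure_def by (subst AE_density) simp_all
  qed
  also have "\<dots> = measure (depth_measure (\<lambda>v. v)) {?d<..}"
    by (simp only: nn_integral_mean_rate measure_def)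
  also have "\<dots> = measure (depth_measure (\<lambda>v. v)) {?d..}"
    by (rule D.finite_measure_eq_AE)
      (auto intro!: AE_I[of _ _ "{?d}"] simp: depth_measure_no_atom[where f = "\<lambda>v. v", OF rate_weight])
  finally show ?thesis by (simp add: depth_tail_def)
qed

end

section \<open>Convergence of averages over the items\<close>

definition average :: "nat \<Rightarrow> (nat \<Rightarrow> 'b) \<Rightarrow> ('b \<Rightarrow> real) \<Rightarrow> real" where
  "average N c f = (\<Sum>i\<in>{1..N}. f (c i)) / real N"

lemma integral_empirical:
  fixes f :: "'b::topological_space \<Rightarrow> real"
  assumes "1 \<le> N" and f: "f \<in> borel_measurable borel"
  shows "(LINT p|empirical N c. f p) = average N c f"
proof -
  have "c \<in> uniform_count_measure {1..N} \<rightarrow>\<^sub>M borel"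
    by (simp add: measurable_def sets_uniform_count_measure space_uniform_count_measure)
  then have "(LINT p|empirical N c. f p) = (LINT i|uniform_count_measure {1..N}. f (c i))"
    unfolding empirical_def by (rule integral_distr[OF _ f])
  also have "\<dots> = average N c f"
    by (subst integral_uniform_count_measure) (simp_all add: average_def)
  finally show ?thesis .
qed

lemma prob_space_empirical: "1 \<le> N \<Longrightarrow> prob_space (empirical N c)"
  unfolding empirical_def
  by (intro prob_space.prob_space_distr prob_space_uniform_count_measure)
    (auto simp: measurable_def sets_uniform_count_measure space_uniform_count_measure)

lemma average_mono: "(\<And>i. i \<in> {1..N} \<Longrightarrow> f (c i) \<le> g (c i)) \<Longrightarrow> average N c f \<le> average N c g"
  unfolding average_def by (intro divide_right_mono sum_mono) auto

lemma average_add: "average N c (\<lambda>p. f p + g p) = average N c f + average N c g"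
  by (simp add: average_def sum.distrib add_divide_distrib)

lemma weak_conv_on_average:
  fixes S :: "'b::topological_space set" and f :: "'b \<Rightarrow> real"
  assumes conv: "weak_conv_on S (\<lambda>N. empirical N (c N)) Q" and Q: "distribution_on S Q"
    and c: "\<And>N i. i \<in> {1..N} \<Longrightarrow> c N i \<in> S" and S: "S \<in> sets borel"
    and f: "continuous_on UNIV f" and bd: "\<And>p. p \<in> S \<Longrightarrow> \<bar>f p\<bar> \<le> B"
  shows "(\<lambda>N. average N (c N) f) \<longlonglongrightarrow> (LINT p|Q. f p)"
proof -
  have fm: "f \<in> borel_measurable borel" by (rule borel_measurable_continuous_onI[OF f])
  have ifm: "(\<lambda>p. indicator S p *\<^sub>R f p) \<in> borel_measurable borel"
    using fm S by (intro borel_measurable_scaleR) auto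
  have "bounded (f ` S)" using bd by (auto simp: bounded_iff)
  moreover have "continuous_on S f" by (rule continuous_on_subset[OF f]) simp
  ultimately have lim: "(\<lambda>N. LINT p:S|empirical N (c N). f p) \<longlonglongrightarrow> (LINT p:S|Q. f p)"
    using conv unfolding weak_conv_on_def by blast
  have "(LINT p:S|Q. f p) = (LINT p|Q. f p)"
    unfolding set_lebesgue_integral_def
  proof (rule integral_cong_AE)
    have sQ: "sets Q = sets borel" using Q by (simp add: distribution_on_def)
    show "(\<lambda>p. indicator S p *\<^sub>R f p) \<in> borel_measurable Q" "f \<in> borel_measurable Q"
      using fm ifm measurable_cong_sets[OF sQ refl] by blast+
    have "AE p in Q. p \<in> S" using Q by (simp add: distribution_on_def)
    then show "AE p in Q. indicator S p *\<^sub>R f p = f p" by eventually_elim simp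
  qed
  moreover have "\<forall>\<^sub>F N in sequentially. (LINT p:S|empirical N (c N). f p) = average N (c N) f"
    using eventually_ge_at_top[of 1]
  proof eventually_elim
    case (elim N)
    then have "(LINT p:S|empirical N (c N). f p) = average N (c N) (\<lambda>p. indicator S p *\<^sub>R f p)"
      unfolding set_lebesgue_integral_def by (rule integral_empirical[OF _ ifm])
    also have "\<dots> = average N (c N) f" using c[of _ N] by (simp add: average_def)
    finally show ?case .
  qed
  ultimately show ?thesis using Lim_transform_eventually[OF lim] by simp
qed

text \<open>
  The rates alone converge weakly to \<open>lam\<close> and, as a marginal of the joint convergence, to the first
  marginal of \<open>Q\<close>; weak limits are unique because characteristic functions determine a distribution.
\<close>

lemma weak_limit_marginal:
  fixes c :: "nat \<Rightarrow> nat \<Rightarrow> real \<times> real"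
  assumes conv: "weak_conv_on S (\<lambda>N. empirical N (c N)) Q" and Q: "distribution_on S Q"
    and c: "\<And>N i. i \<in> {1..N} \<Longrightarrow> c N i \<in> S" and S: "S \<in> sets borel"
    and lam: "real_distribution lam"
    and rate: "weak_conv_m (\<lambda>N. empirical N (\<lambda>i. fst (c N i))) lam"
  shows "distr Q borel fst = lam"
proof -
  define E where "E n = empirical (Suc n) (\<lambda>i. fst (c (Suc n) i))" for n
  interpret Q: prob_space Q using Q by (simp add: distribution_on_def)
  have sQ: "sets Q = sets borel" using Q by (simp add: distribution_on_def)
  have fstQ: "fst \<in> borel_measurable Q"
    using measurable_fst_borel measurable_cong_sets[OF sQ refl] by blast
  have E: "real_distribution (E n)" for n
    unfolding E_def real_distribution_def real_distribution_axioms_def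
    using prob_space_empirical[of "Suc n"] by (simp add: empirical_def)
  have D: "real_distribution (distr Q borel fst)"
    unfolding real_distribution_def real_distribution_axioms_def
    using Q.prob_space_distr[OF fstQ] by simp
  have "weak_conv_m E lam"
    using rate unfolding weak_conv_m_def weak_conv_def E_def by (auto intro: LIMSEQ_Suc)
  then have 1: "(\<lambda>n. char (E n) s) \<longlonglongrightarrow> char lam s" for s by (rule levy_continuity1[OF E lam])
  have "weak_conv_m E (distr Q borel fst)"
  proof (rule integral_cts_step_conv_imp_weak_conv[OF E D])
    fix a b :: real assume ab: "a < b"
    have cont: "continuous_on UNIV (cts_step a b)"
      using cts_step_uniformly_continuous[OF ab] by (rule uniformly_continuous_imp_continuous)
    then have m: "cts_step a b \<in> borel_measurable borel" by (rule borel_measurable_continuous_onI)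
    have "(\<lambda>N. average N (c N) (\<lambda>p. cts_step a b (fst p))) \<longlonglongrightarrow> (LINT p|Q. cts_step a b (fst p))"
    proof (rule weak_conv_on_average[OF conv Q c S])
      show "continuous_on UNIV (\<lambda>p :: real \<times> real. cts_step a b (fst p))"
        by (intro continuous_on_compose2[OF cont] continuous_intros) auto
      show "\<bar>cts_step a b (fst p)\<bar> \<le> 1" for p :: "real \<times> real"
        using ab by (auto simp: cts_step_def divide_le_eq)
    qed
    then have "(\<lambda>n. average (Suc n) (c (Suc n)) (\<lambda>p. cts_step a b (fst p))) \<longlonglongrightarrow> (LINT p|Q. cts_step a b (fst p))"
      by (rule LIMSEQ_Suc)
    moreover have "integral\<^sup>L (E n) (cts_step a b) = average (Suc n) (c (Suc n)) (\<lambda>p. cts_step a b (fst p))" for n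
      unfolding E_def by (subst integral_empirical[OF _ m]) (simp_all add: average_def)
    moreover have "integral\<^sup>L (distr Q borel fst) (cts_step a b) = (LINT p|Q. cts_step a b (fst p))"
      by (rule integral_distr[OF fstQ m])
    ultimately show "(\<lambda>n. integral\<^sup>L (E n) (cts_step a b)) \<longlonglongrightarrow> integral\<^sup>L (distr Q borel fst) (cts_step a b)"
      by simp
  qed
  then have 2: "(\<lambda>n. char (E n) s) \<longlonglongrightarrow> char (distr Q borel fst) s" for s by (rule levy_continuity1[OF E D])
  show ?thesis
    by (rule Levy_uniqueness[OF D lam]) (use LIMSEQ_unique[OF 2 1] in auto)
qed

locale converging_rankings = ranking_limit +
  fixes c :: "nat \<Rightarrow> nat \<Rightarrow> real \<times> real"
  assumes conv: "weak_conv_on ({0..} \<times> {0..<1}) (\<lambda>N. empirical N (c N)) mu0"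
    and c: "\<And>N i. i \<in> {1..N} \<Longrightarrow> c N i \<in> {0..} \<times> {0..<1}"
    and mean: "(\<lambda>N. average N (c N) fst) \<longlonglongrightarrow> (LINT v|lam. v)"
begin

lemma average_conv_bounded:
  assumes "continuous_on UNIV f" "\<And>p. p \<in> {0..} \<times> {0..<1} \<Longrightarrow> \<bar>f p\<bar> \<le> B"
  shows "(\<lambda>N. average N (c N) f) \<longlonglongrightarrow> (LINT p|mu0. f p)"
  by (rule weak_conv_on_average[OF conv mu0 c _ assms]) (auto simp: borel_prod[symmetric])

text \<open>
  The analogue of Fatou's lemma: truncation at \<open>k\<close> makes the function bounded and decreases its
  averages.
\<close>

lemma average_conv_lower:
  assumes f: "continuous_on UNIV f" "\<And>p. p \<in> {0..} \<times> {0..<1} \<Longrightarrow> 0 \<le> f p" "integrable mu0 f"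
    and b: "b < (LINT p|mu0. f p)"
  shows "\<forall>\<^sub>F N in sequentially. b < average N (c N) f"
proof -
  have fm: "f \<in> borel_measurable mu0" using f(3) by (rule borel_measurable_integrable)
  have "(\<lambda>k. LINT p|mu0. min (f p) (real k)) \<longlonglongrightarrow> (LINT p|mu0. f p)"
  proof (rule integral_dominated_convergence[where w = f])
    show "AE p in mu0. (\<lambda>k. min (f p) (real k)) \<longlonglongrightarrow> f p"
    proof (intro AE_I2 tendsto_eventually)
      fix p
      show "\<forall>\<^sub>F k in sequentially. min (f p) (real k) = f p"
        using eventually_ge_at_top[of "nat \<lceil>f p\<rceil>"] by eventually_elim (simp add: min_def; linarith)
    qed
    show "AE p in mu0. norm (min (f p) (real k)) \<le> f p" for k
      using AE_initial_limit by eventually_elim (use f(2) in \<open>auto simp: mem_Times_iff\<close>)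
  qed (use f fm in auto)
  then have "\<forall>\<^sub>F k in sequentially. b < (LINT p|mu0. min (f p) (real k))"
    using b by (rule order_tendstoD)
  then obtain k where k: "b < (LINT p|mu0. min (f p) (real k))"
    by (auto dest: eventually_happens)
  have "(\<lambda>N. average N (c N) (\<lambda>p. min (f p) (real k))) \<longlonglongrightarrow> (LINT p|mu0. min (f p) (real k))"
    by (rule average_conv_bounded[where B = "real k"]) (use f(2) in \<open>auto intro!: continuous_intros f(1)\<close>)
  then have "\<forall>\<^sub>F N in sequentially. b < average N (c N) (\<lambda>p. min (f p) (real k))"
    using k by (rule order_tendstoD)
  then show ?thesis
    by (rule eventually_mono) (erule less_le_trans, rule average_mono, simp)
qed

text \<open>
  Convergence of the mean rate excludes a loss of mass at infinity: apply the lower bound to \<open>f\<close> and to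
  \<open>1 + v - f\<close>, both nonnegative, and compare with the convergence of the averages of \<open>1 + v\<close>.
\<close>

lemma average_conv_linear_growth:
  assumes f: "continuous_on UNIV f" "\<And>p. p \<in> {0..} \<times> {0..<1} \<Longrightarrow> 0 \<le> f p \<and> f p \<le> 1 + fst p"
  shows "(\<lambda>N. average N (c N) f) \<longlonglongrightarrow> (LINT p|mu0. f p)"
proof -
  have i1: "integrable mu0 (\<lambda>p. 1 + fst p)"
    using integrable_f_fst[OF rate_weight] by simp
  have fm: "f \<in> borel_measurable mu0"
    using borel_measurable_continuous_onI[OF f(1)] measurable_cong_sets[OF sets_initial_limit refl] by blast
  have fi: "integrable mu0 f"
  proof (rule Bochner_Integration.integrable_bound[OF i1 fm])
    show "AE p in mu0. norm (f p) \<le> norm (1 + fst p)"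
      using AE_initial_limit by eventually_elim (use f(2) in \<open>force simp: mem_Times_iff\<close>)
  qed
  have m: "(LINT p|mu0. fst p) = (LINT v|lam. v)"
    unfolding marginal[symmetric] by (rule integral_distr[symmetric]) simp_all
  show ?thesis
  proof (rule order_tendstoI)
    fix b assume "b < (LINT p|mu0. f p)"
    then show "\<forall>\<^sub>F N in sequentially. b < average N (c N) f"
      using average_conv_lower[OF f(1) _ fi] f(2) by blast
  next
    fix b assume b: "(LINT p|mu0. f p) < b"
    define e where "e = (b - (LINT p|mu0. f p)) / 2"
    have e: "0 < e" "b = (LINT p|mu0. f p) + 2 * e" using b by (auto simp: e_def field_simps)
    have "\<forall>\<^sub>F N in sequentially. (LINT p|mu0. 1 + fst p - f p) - e < average N (c N) (\<lambda>p. 1 + fst p - f p)"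
    proof (rule average_conv_lower)
      show "continuous_on UNIV (\<lambda>p. 1 + fst p - f p)" by (intro continuous_intros f(1))
      show "integrable mu0 (\<lambda>p. 1 + fst p - f p)" by (rule Bochner_Integration.integrable_diff[OF i1 fi])
    qed (use f(2) e in auto)
    moreover have "\<forall>\<^sub>F N in sequentially. average N (c N) fst < (LINT v|lam. v) + e"
      using order_tendstoD(2)[OF mean] e by simp
    ultimately show "\<forall>\<^sub>F N in sequentially. average N (c N) f < b"
      using eventually_ge_at_top[of 1]
    proof eventually_elim
      case (elim N)
      have "average N (c N) (\<lambda>p. (1 + fst p - f p) + f p) = average N (c N) (\<lambda>p. 1 + fst p - f p) + average N (c N) f"
        by (rule average_add)
      moreover have "average N (c N) (\<lambda>p. (1 + fst p - f p) + f p) = average N (c N) (\<lambda>_. 1) + average N (c N) fst"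
        by (simp add: average_add[symmetric])
      moreover have "average N (c N) (\<lambda>_. 1) = 1" using elim(3) by (simp add: average_def)
      moreover have "(LINT p|mu0. 1 + fst p - f p) = 1 + (LINT v|lam. v) - (LINT p|mu0. f p)"
        using fi integrable_f_fst[OF rate_weight] m mu0.prob_space by simp
      ultimately show ?case using elim e by linarith
    qed
  qed
qed

text \<open>
  \<open>survival t r\<close> jumps at initial position \<open>r\<close>.  For \<open>a < b\<close> the continuous function \<open>g a b\<close>, with a linear
  ramp in the position from \<open>a\<close> to \<open>b\<close>, lies between the weighted survival functions at \<open>b\<close> and at
  \<open>a\<close>; continuity of \<open>depth_tail f\<close> closes the gap.
\<close>

lemma average_survival_conv:
  assumes f: "continuous_on UNIV f" "\<forall>v\<ge>0. 0 \<le> f v" "\<And>v. 0 \<le> v \<Longrightarrow> f v \<le> 1 + v" "integrable lam f"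
    and r: "- t < r"
  shows "(\<lambda>N. average N (c N) (\<lambda>p. f (fst p) * survival t r p)) \<longlonglongrightarrow> depth_tail f r"
proof -
  have fm: "f \<in> borel_measurable borel" by (rule borel_measurable_continuous_onI[OF f(1)])
  note tail = depth_tail_eq[OF fm f(2) f(4)]
  have AE_S: "AE p in mu0. p \<in> {0..} \<times> {0..<1}"
    using AE_initial_limit by eventually_elim (simp add: mem_Times_iff)
  define g where "g a b p = f (fst p) * (exp (- fst p * (t + min 0 b)) * max 0 (min 1 ((snd p - a) / (b - a))))"
    for a b and p :: "real \<times> real"
  have g_low: "f (fst p) * survival t b p \<le> g a b p" and g_up: "g a b p \<le> f (fst p) * survival t a p"
    if ab: "- t \<le> a" "a < b" and p: "p \<in> {0..} \<times> {0..<1}" for a b p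
  proof -
    have fp: "0 \<le> f (fst p)" using f(2) p by (simp add: mem_Times_iff)
    have "survival t b p \<le> exp (- fst p * (t + min 0 b)) * max 0 (min 1 ((snd p - a) / (b - a)))"
      using ab by (auto simp: survival_def field_simps)
    then show "f (fst p) * survival t b p \<le> g a b p" unfolding g_def by (intro mult_left_mono fp)
    have "exp (- fst p * (t + min 0 b)) * max 0 (min 1 ((snd p - a) / (b - a))) \<le> survival t a p"
    proof (cases "a \<le> snd p")
      case True
      have "fst p * (t + min 0 a) \<le> fst p * (t + min 0 b)" using p ab by (intro mult_left_mono) (simp_all add: mem_Times_iff)
      then have "exp (- fst p * (t + min 0 b)) * max 0 (min 1 ((snd p - a) / (b - a))) \<le> exp (- fst p * (t + min 0 a)) * 1"
        by (intro mult_mono) auto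
      then show ?thesis using True by (simp add: survival_def)
    next
      case False
      then have "(snd p - a) / (b - a) \<le> 0" using ab by (simp add: divide_le_0_iff)
      then show ?thesis by simp
    qed
    then show "g a b p \<le> f (fst p) * survival t a p" unfolding g_def by (intro mult_left_mono fp)
  qed
  have g_cont: "continuous_on UNIV (g a b)" if "a < b" for a b
    unfolding g_def[abs_def] using that by (intro continuous_intros continuous_on_compose2[OF f(1)]) auto
  have g_lim: "(\<lambda>N. average N (c N) (g a b)) \<longlonglongrightarrow> (LINT p|mu0. g a b p)" and
    g_int: "integrable mu0 (g a b)" if ab: "- t \<le> a" "a < b" for a b
  proof -
    have le: "0 \<le> g a b p \<and> g a b p \<le> f (fst p)" if p: "p \<in> {0..} \<times> {0..<1}" for p
    proof -
      have fp: "0 \<le> f (fst p)" using f(2) p by (simp add: mem_Times_iff)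
      have "survival t a p \<le> 1" using p ab t by (simp add: survival_def mem_Times_iff)
      then have "f (fst p) * survival t a p \<le> f (fst p)" using fp by (intro mult_left_le)
      moreover have "0 \<le> f (fst p) * survival t b p" using fp by simp
      ultimately show ?thesis using g_low[OF ab p] g_up[OF ab p] by linarith
    qed
    show "(\<lambda>N. average N (c N) (g a b)) \<longlonglongrightarrow> (LINT p|mu0. g a b p)"
    proof (rule average_conv_linear_growth[OF g_cont[OF ab(2)]])
      fix p :: "real \<times> real" assume p: "p \<in> {0..} \<times> {0..<1}"
      then show "0 \<le> g a b p \<and> g a b p \<le> 1 + fst p" using le[OF p] f(3)[of "fst p"] by (simp add: mem_Times_iff)
    qed
    have gm: "g a b \<in> borel_measurable mu0"
      using borel_measurable_continuous_onI[OF g_cont[OF ab(2)]] measurable_cong_sets[OF sets_initial_limit refl] by blast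
    show "integrable mu0 (g a b)"
    proof (rule Bochner_Integration.integrable_bound[OF integrable_f_fst[OF fm f(2) f(4)] gm])
      show "AE p in mu0. norm (g a b p) \<le> norm (f (fst p))"
        using AE_initial_limit by eventually_elim (use le in \<open>force simp: mem_Times_iff\<close>)
    qed
  qed
  have int_low: "depth_tail f b \<le> (LINT p|mu0. g a b p)" and int_up: "(LINT p|mu0. g a b p) \<le> depth_tail f a"
    if ab: "- t \<le> a" "a < b" for a b
  proof -
    have ab': "- t \<le> b" using ab by simp
    note int = integrable_f_survival[OF fm f(2) f(4)]
    have "AE p in mu0. f (fst p) * survival t b p \<le> g a b p"
      using AE_S by eventually_elim (rule g_low[OF ab])
    then show "depth_tail f b \<le> (LINT p|mu0. g a b p)"
      unfolding tail[OF ab'] by (rule integral_mono_AE[OF int[OF ab'] g_int[OF ab]])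
    have "AE p in mu0. g a b p \<le> f (fst p) * survival t a p"
      using AE_S by eventually_elim (rule g_up[OF ab])
    then show "(LINT p|mu0. g a b p) \<le> depth_tail f a"
      unfolding tail[OF ab(1)] by (rule integral_mono_AE[OF g_int[OF ab] int[OF ab(1)]])
  qed
  have cont: "isCont (depth_tail f) r" by (rule isCont_depth_tail[OF fm f(2) f(4)])
  show ?thesis
  proof (rule order_tendstoI)
    fix e assume e: "e < depth_tail f r"
    have "(depth_tail f \<longlongrightarrow> depth_tail f r) (at_right r)"
      using cont unfolding isCont_def by (rule filterlim_mono[OF _ order_refl at_le]) simp
    then have "\<forall>\<^sub>F b in at_right r. e < depth_tail f b \<and> r < b"
      by (intro eventually_conj order_tendstoD(1)[OF _ e] eventually_at_right_less)
    then have "\<exists>b. e < depth_tail f b \<and> r < b"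
      by (rule eventually_happens'[OF trivial_limit_at_right_real])
    then obtain b where b: "e < depth_tail f b" "r < b" by blast
    have "\<forall>\<^sub>F N in sequentially. e < average N (c N) (g r b)"
      using order_tendstoD(1)[OF g_lim[of r b]] int_low[of r b] b r by simp
    then show "\<forall>\<^sub>F N in sequentially. e < average N (c N) (\<lambda>p. f (fst p) * survival t r p)"
      by (rule eventually_mono) (erule less_le_trans, rule average_mono, rule g_up, use r b c in auto)
  next
    fix e assume e: "depth_tail f r < e"
    have "(depth_tail f \<longlongrightarrow> depth_tail f r) (at_left r)"
      using cont unfolding isCont_def by (rule filterlim_mono[OF _ order_refl at_le]) simp
    then have "\<forall>\<^sub>F a in at_left r. depth_tail f a < e \<and> a \<in> {- t<..<r}"
      by (intro eventually_conj order_tendstoD(2)[OF _ e] eventually_at_left_real r)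
    then have "\<exists>a. depth_tail f a < e \<and> a \<in> {- t<..<r}"
      by (rule eventually_happens'[OF trivial_limit_at_left_real])
    then obtain a where a: "depth_tail f a < e" "- t < a" "a < r" by auto
    have "\<forall>\<^sub>F N in sequentially. average N (c N) (g a r) < e"
      using order_tendstoD(2)[OF g_lim[of a r]] int_up[of a r] a by simp
    then show "\<forall>\<^sub>F N in sequentially. average N (c N) (\<lambda>p. f (fst p) * survival t r p) < e"
      by (rule eventually_mono) (erule le_less_trans[rotated], rule average_mono, rule g_low, use a c in auto)
  qed
qed

end

theorem mainTheorem2:
  fixes M :: "nat \<Rightarrow> 'a measure"
    and w :: "nat \<Rightarrow> nat \<Rightarrow> real"
    and x0 :: "nat \<Rightarrow> nat \<Rightarrow> nat"
    and \<tau> :: "nat \<Rightarrow> nat \<Rightarrow> nat \<Rightarrow> 'a \<Rightarrow> real"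
    and X :: "nat \<Rightarrow> nat \<Rightarrow> real \<Rightarrow> 'a \<Rightarrow> nat"
    and lam :: "real measure"
    and \<mu>0 :: "(real \<times> real) measure"
    and K :: "real \<Rightarrow> real measure"
    and t x :: real
  assumes process: "\<And>N. N \<ge> 1 \<Longrightarrow> stochastic_ranking_process (M N) N (w N) (x0 N) (\<tau> N) (X N)"
    and rate_limit: "distribution_on {0..} lam" "measure lam {0} = 0" "integrable lam (\<lambda>v. v)"
    and rate_conv: "weak_conv_m (\<lambda>N. empirical N (w N)) lam"
    and mean_conv: "(\<lambda>N. LINT v|empirical N (w N). v) \<longlonglongrightarrow> (LINT v|lam. v)"
    and initial_limit: "distribution_on ({0..} \<times> {0..<1}) \<mu>0"
      "distr \<mu>0 borel snd = uniform_measure lborel {0..<1}" "disintegrates \<mu>0 K"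
    and initial_conv: "weak_conv_on ({0..} \<times> {0..<1})
      (\<lambda>N. empirical N (\<lambda>i. (w N i, (real (x0 N i) - 1) / real N))) \<mu>0"
    and t: "0 \<le> t" and x: "0 \<le> x" "x < 1"
  shows "(\<lambda>N. measure (M N) {\<omega> \<in> space (M N). x < real (search_cost N (\<tau> N) (X N) t \<omega>) / real N})
    \<longlonglongrightarrow> (LINT y:{x<..<1}|lborel. LINT v|limit_distribution lam K y t. v) / (LINT v|lam. v)"
proof -
  define c where "c N i = (w N i, (real (x0 N i) - 1) / real N)" for N i
  let ?S = "{0..} \<times> {0..<1} :: (real \<times> real) set"
  have c: "c N i \<in> ?S" if i: "i \<in> {1..N}" for N i
  proof -
    interpret stochastic_ranking_process "M N" N "w N" "x0 N" "\<tau> N" "X N" by (rule process) (use i in simp)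
    have "x0 N i \<in> {1..N}" by (rule bij_betw_apply[OF initial_permutation i])
    then show ?thesis using rate_pos[OF i] by (simp add: c_def field_simps)
  qed
  have lamr: "real_distribution lam"
    using rate_limit(1) unfolding distribution_on_def real_distribution_def real_distribution_axioms_def by blast
  have conv: "weak_conv_on ?S (\<lambda>N. empirical N (c N)) \<mu>0" using initial_conv unfolding c_def .
  have marginal: "distr \<mu>0 borel fst = lam"
    by (rule weak_limit_marginal[OF conv initial_limit(1) c _ lamr])
      (use rate_conv in \<open>simp_all add: c_def borel_prod[symmetric]\<close>)
  have mean_eq: "\<forall>\<^sub>F N in sequentially. (LINT v|empirical N (w N). v) = average N (c N) fst"
    using eventually_ge_at_top[of 1]
    by eventually_elim (subst integral_empirical, simp_all add: average_def c_def)
  have mean: "(\<lambda>N. average N (c N) fst) \<longlonglongrightarrow> (LINT v|lam. v)"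
    by (rule Lim_transform_eventually[OF mean_conv mean_eq])
  interpret converging_rankings lam \<mu>0 K t c
    by unfold_locales (fact rate_limit initial_limit marginal t conv mean | erule c)+
  let ?m = "LINT v|lam. v" and ?d = "depth_at x"
  let ?p = "\<lambda>N. measure (M N) {\<omega> \<in> space (M N). x < real (search_cost N (\<tau> N) (X N) t \<omega>) / real N}"
  define G where "G = depth_tail (\<lambda>v. v)"
  define q where "q r N = average N (c N) (\<lambda>p. fst p * survival t r p) / average N (c N) fst" for r N
  have mpos: "0 < ?m"
  proof -
    have "(LINT v|lam. 0) < ?m"
      by (rule lam.integral_less_AE_space) (use rate_limit(3) AE_rate_pos lam.emeasure_space_1 in auto)
    then show ?thesis by simp
  qed
  have d: "- t \<le> ?d" "?d < 1" "position ?d = x"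
    using depth_at[of x] depth_at_less_one[of x] x by auto
  have q_lim: "q r \<longlonglongrightarrow> G r / ?m" if "- t < r" for r
    unfolding q_def G_def using mpos
    by (intro tendsto_divide mean average_survival_conv[where f = "\<lambda>v. v", OF _ rate_weight(2) _ rate_weight(3)] that) auto
  have pos_lim: "(\<lambda>N. 1 - average N (c N) (survival t r)) \<longlonglongrightarrow> position r" if "- t < r" for r
    using tendsto_diff[OF tendsto_const average_survival_conv[where f = "\<lambda>_. 1", OF _ constant_weight(2) _ constant_weight(3) that], of 1]
    unfolding position_def by simp
  have err: "(\<lambda>N. exp (- 2 * \<delta>\<^sup>2 * real N)) \<longlonglongrightarrow> 0" if "0 < \<delta>" for \<delta> :: real
  proof -
    have "exp (- 2 * \<delta>\<^sup>2 * real N) = exp (- 2 * \<delta>\<^sup>2) ^ N" for N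
      by (simp add: exp_of_nat_mult[symmetric] mult.commute)
    then show ?thesis using that by (simp add: LIMSEQ_power_zero)
  qed
  have q_alt: "(\<Sum>i\<in>{1..N}. w N i * survival t r (w N i, (real (x0 N i) - 1) / real N)) / (\<Sum>i\<in>{1..N}. w N i) = q r N"
    and A_alt: "(\<Sum>i\<in>{1..N}. survival t r (w N i, (real (x0 N i) - 1) / real N)) / real N = average N (c N) (survival t r)"
    if "1 \<le> N" for r N
    using that by (simp_all add: q_def average_def c_def)
  \<comment> \<open>At a level \<open>r\<close> beyond \<open>depth_at x\<close> the fraction of shallower items exceeds \<open>x\<close> by a margin, so the lower
      tail bound applies; below \<open>depth_at x\<close> the upper one does.\<close>
  have lower: "\<forall>\<^sub>F N in sequentially. e < ?p N" if r: "?d < r" "r < 1" and e: "e < G r / ?m" for r e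
  proof -
    define \<delta> where "\<delta> = (position r - x) / 2"
    have "x < position r" using position_strict_mono[of ?d r] d r by simp
    then have \<delta>: "0 < \<delta>" "x + \<delta> < position r" by (auto simp: \<delta>_def field_simps)
    have r': "- t < r" using d r by simp
    have "(\<lambda>N. q r N - exp (- 2 * \<delta>\<^sup>2 * real N)) \<longlonglongrightarrow> G r / ?m - 0"
      by (intro tendsto_diff q_lim r' err \<delta>)
    then have "\<forall>\<^sub>F N in sequentially. e < q r N - exp (- 2 * \<delta>\<^sup>2 * real N)"
      using e by (intro order_tendstoD) simp_all
    moreover have "\<forall>\<^sub>F N in sequentially. x + \<delta> < 1 - average N (c N) (survival t r)"
      using pos_lim[OF r'] \<delta>(2) by (rule order_tendstoD)
    ultimately show ?thesis using eventually_ge_at_top[of 1]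
    proof eventually_elim
      case (elim N)
      interpret P: stochastic_ranking_process "M N" N "w N" "x0 N" "\<tau> N" "X N" by (rule process) fact
      have "q r N - exp (- 2 * \<delta>\<^sup>2 * real N) \<le> ?p N"
        using P.search_cost_tail_lower[OF elim(3) _ t \<delta>(1), of r x] elim(2) r' unfolding q_alt[OF elim(3)] A_alt[OF elim(3)] by simp
      then show ?case using elim(1) by simp
    qed
  qed
  have upper: "\<forall>\<^sub>F N in sequentially. ?p N < e" if r: "- t < r" "r < ?d" and e: "G r / ?m < e" for r e
  proof -
    define \<delta> where "\<delta> = (x - position r) / 2"
    have "position r < x" using position_strict_mono[of r ?d] d r by simp
    then have \<delta>: "0 < \<delta>" "position r < x - \<delta>" by (auto simp: \<delta>_def field_simps)
    have "(\<lambda>N. q r N + exp (- 2 * \<delta>\<^sup>2 * real N)) \<longlonglongrightarrow> G r / ?m + 0"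
      by (intro tendsto_add q_lim r err \<delta>)
    then have "\<forall>\<^sub>F N in sequentially. q r N + exp (- 2 * \<delta>\<^sup>2 * real N) < e"
      using e by (intro order_tendstoD) simp_all
    moreover have "\<forall>\<^sub>F N in sequentially. 1 - average N (c N) (survival t r) < x - \<delta>"
      using pos_lim[OF r(1)] \<delta>(2) by (rule order_tendstoD)
    ultimately show ?thesis using eventually_ge_at_top[of 1]
    proof eventually_elim
      case (elim N)
      interpret P: stochastic_ranking_process "M N" N "w N" "x0 N" "\<tau> N" "X N" by (rule process) fact
      have "?p N \<le> q r N + exp (- 2 * \<delta>\<^sup>2 * real N)"
        using P.search_cost_tail_upper[OF elim(3) _ t \<delta>(1), of r x] elim(2) r unfolding q_alt[OF elim(3)] A_alt[OF elim(3)] by simp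
      then show ?case using elim(1) by simp
    qed
  qed
  have cont: "isCont (\<lambda>r. G r / ?m) ?d"
    unfolding G_def using mpos isCont_depth_tail[OF rate_weight] by (intro continuous_intros) auto
  have "?p \<longlonglongrightarrow> G ?d / ?m"
  proof (rule order_tendstoI)
    fix e assume e: "e < G ?d / ?m"
    have "((\<lambda>r. G r / ?m) \<longlongrightarrow> G ?d / ?m) (at_right ?d)"
      using cont unfolding isCont_def by (rule filterlim_mono[OF _ order_refl at_le]) simp
    then have "\<forall>\<^sub>F r in at_right ?d. e < G r / ?m \<and> r \<in> {?d<..<1}"
      by (intro eventually_conj order_tendstoD(1)[OF _ e] eventually_at_right_real d)
    then have "\<exists>r. e < G r / ?m \<and> r \<in> {?d<..<1}"
      by (rule eventually_happens'[OF trivial_limit_at_right_real])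
    then show "\<forall>\<^sub>F N in sequentially. e < ?p N" using lower by auto
  next
    fix e assume e: "G ?d / ?m < e"
    show "\<forall>\<^sub>F N in sequentially. ?p N < e"
    proof (cases "- t < ?d")
      case True
      have "((\<lambda>r. G r / ?m) \<longlongrightarrow> G ?d / ?m) (at_left ?d)"
        using cont unfolding isCont_def by (rule filterlim_mono[OF _ order_refl at_le]) simp
      then have "\<forall>\<^sub>F r in at_left ?d. G r / ?m < e \<and> r \<in> {- t<..<?d}"
        by (intro eventually_conj order_tendstoD(2)[OF _ e] eventually_at_left_real True)
      then have "\<exists>r. G r / ?m < e \<and> r \<in> {- t<..<?d}"
        by (rule eventually_happens'[OF trivial_limit_at_left_real])
      then show ?thesis using upper by auto
    next
      \<comment> \<open>There is no level below \<open>-t\<close>, but then the limit is 1 and the upper bound is trivial.\<close>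
      case False
      then have dt: "?d = - t" using d by simp
      have "G (- t) = (LINT p|\<mu>0. fst p)"
        unfolding G_def depth_tail_eq[OF rate_weight order_refl]
      proof (rule integral_cong_AE)
        show "AE p in \<mu>0. fst p * survival t (- t) p = fst p"
          using AE_initial_limit by eventually_elim (use t in \<open>simp add: survival_def\<close>)
      qed (simp_all add: measurable_f_survival[OF rate_weight] measurable_fst_mu0)
      also have "\<dots> = ?m" unfolding marginal[symmetric] by (rule integral_distr[symmetric]) simp_all
      finally have "1 < e" using e mpos unfolding dt by simp
      show ?thesis using eventually_ge_at_top[of 1]
      proof eventually_elim
        case (elim N)
        interpret P: stochastic_ranking_process "M N" N "w N" "x0 N" "\<tau> N" "X N" by (rule process) fact
        show ?case using \<open>1 < e\<close> by (rule le_less_trans[OF P.prob_le_1])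
      qed
    qed
  qed
  then show ?thesis unfolding integral_limit_distribution[OF x] G_def .
qed

end
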